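(* Let $k$ and $n$ be positive integers. For $m\in\{0,1,2\}$, we have $$(-1)^{k-1}\left(C_m(n)-\sum_{j=-k}^{k}(-1)^j\,u_m\big(n-j(3j-1)/2\big)\right)\geqslant 0.$$
   Context: Unimodal compositions. A composition of a positive integer $n$ is a sequence $(\lambda_1,\ldots,\lambda_r)$ of positive integers (parts) with sum $n$. It is unimodal if there exists $t\in\{1,\ldots,r\}$ with $\lambda_1\leqslant\cdots\leqslant\lambda_t$ and $\lambda_t\geqslant\cdots\geqslant\lambda_r$. For $n\geqslant 1$, $u_0(n)$ is the number of unimodal compositions of $n$, and $u_0(0)=0$. For $m\geqslant1$ and $n\geqslant0$, $u_m(n)$ is the number of unimodal compositions of $n+m$ in which the maximal part appears exactly $m$ times; in particular $u_m(0)=1$. Convention: $u_m(n)=0$ for $n<0$. Crank. For a partition $\lambda=(\lambda_1\geqslant\lambda_2\geqslant\cdots)$, let $\omega(\lambda)$ be the number of parts of $\lambda$ equal to $1$, and $\mu(\lambda)$ the number of parts of $\lambda$ larger than $\omega(\lambda)$. The crank is $c(\lambda)=\lambda_1$ (the largest part) if $\omega(\lambda)=0$, and $c(\lambda)=\mu(\lambda)-\omega(\lambda)$ if $\omega(\lambda)>0$. For an integer $n\geqslant 2$: $C_0(n)$ is the number of partitions $\lambda$ of $n$ with $c(\lambda)>0$; $C_1(n)$ is the number of partitions $\lambda$ of $n$ with $c(\lambda)\geqslant0$; $C_2(n)$ is the number of partitions $\lambda$ of $n$ with $c(\lambda)=0$. Moreover, by definition, $C_0(1)=1$, $C_1(1)=0$,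 $C_2(1)=-1$. *)

theory Defs
  imports "HOL-Library.Multiset"
begin

definition composition :: "nat list \<Rightarrow> nat \<Rightarrow> bool" where
  "composition xs n \<longleftrightarrow> (\<forall>x\<in>set xs. 0 < x) \<and> sum_list xs = n"

text \<open>The peak is the entry with index \<open>t\<close>, counted from 0; it belongs to both segments.\<close>
definition unimodal :: "nat list \<Rightarrow> bool" where
  "unimodal xs \<longleftrightarrow>
     (\<exists>t<length xs. sorted (take (Suc t) xs) \<and> sorted_wrt (\<ge>) (drop t xs))"

text \<open>The argument is an integer because \<open>u m\<close> is extended by 0 to the negative integers;
  \<open>u 0 0 = 0\<close> is a convention too.\<close>
definition u :: "nat \<Rightarrow> int \<Rightarrow> nat" where
  "u m n =
    (if n < 0 then 0
     else if m = 0 then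
       (if n = 0 then 0 else card {xs. composition xs (nat n) \<and> unimodal xs})
     else card {xs. composition xs (nat n + m) \<and> unimodal xs \<and>
                    count_list xs (Max (set xs)) = m})"

text \<open>A partition is the multiset of its parts.\<close>
definition partition_of :: "nat multiset \<Rightarrow> nat \<Rightarrow> bool" where
  "partition_of p n \<longleftrightarrow> (\<forall>x\<in>#p. 0 < x) \<and> sum_mset p = n"

definition ones :: "nat multiset \<Rightarrow> nat" where
  "ones p = count p 1"

definition parts_above_ones :: "nat multiset \<Rightarrow> nat" where
  "parts_above_ones p = size {#x \<in># p. ones p < x#}"

definition crank :: "nat multiset \<Rightarrow> int" where
  "crank p =
    (if ones p = 0 then int (Max (set_mset p))
     else int (parts_above_ones p) - int (ones p))"

text \<open>The values at \<open>n = 1\<close> are conventions which differ from the actual crank counts there.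
  The values at \<open>n = 0\<close> carry no meaning.\<close>
definition C0 :: "nat \<Rightarrow> int" where
  "C0 n = (if n = 1 then 1 else int (card {p. partition_of p n \<and> 0 < crank p}))"

definition C1 :: "nat \<Rightarrow> int" where
  "C1 n = (if n = 1 then 0 else int (card {p. partition_of p n \<and> 0 \<le> crank p}))"

definition C2 :: "nat \<Rightarrow> int" where
  "C2 n = (if n = 1 then -1 else int (card {p. partition_of p n \<and> crank p = 0}))"

text \<open>Only \<open>m \<le> 2\<close> is meaningful.\<close>
definition C :: "nat \<Rightarrow> nat \<Rightarrow> int" where
  "C m = (if m = 0 then C0 else if m = 1 then C1 else C2)"

end

theory Submission
  imports Defs "HOL-Computational_Algebra.Formal_Power_Series"
begin

text \<open>
  Write \<open>U m\<close> for the generating function of \<open>u m\<close> and \<open>(q)\<close> for Euler's product. For \<open>m > 0\<close>,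
  splitting a unimodal composition at its maximal parts gives \<open>U m = (\<Sum>N. q^(mN) / (q)_N^2)\<close>, and
  \<open>U 0 = U 1 - U 2\<close>. The key fact is that \<open>(q) U m\<close> generates \<open>C m\<close>:

  \<^item> telescoping gives \<open>2 U 1 - U 2 = 1 / (q)^2\<close>, so \<open>2 (q) U 1 = 1 / (q) + (q) U 2\<close>;
  \<^item> a limiting case of Heine's transformation gives
    \<open>(q) U 2 = (1 - q) (\<Sum>w. q^(w^2 + 2w) / (q)_w^2)\<close>, which counts the partitions with \<open>w\<close> ones and
    \<open>w\<close> parts above \<open>w\<close>;
  \<^item> partitions with \<open>w > 0\<close> ones and \<open>s\<close> parts above \<open>w\<close> have a generating function symmetric in
    \<open>w\<close> and \<open>s\<close>, so positive and negative cranks are equinumerous.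

  By the pentagonal number theorem, \<open>C m n\<close> is the full alternating sum of the values of \<open>u m\<close>. The
  truncation error is the tail, an alternating sum with decreasing terms since \<open>u m\<close> is essentially
  monotone.
\<close>

unbundle fps_syntax

section \<open>Alternating and symmetric sums\<close>

lemma sum_atMost_split_0: "(\<Sum>i\<le>n. f i) = f 0 + (\<Sum>i\<in>{1..n}. f i)"
  for f :: "nat \<Rightarrow> 'a :: comm_monoid_add"
proof -
  have "{..n} = insert 0 {1..n}"
    by auto
  then show ?thesis
    by simp
qed

lemma sum_antisymmetric:
  fixes f :: "'a \<Rightarrow> 'a \<Rightarrow> int"
  assumes "\<And>x y. x \<in> S \<Longrightarrow> y \<in> S \<Longrightarrow> f x y = - f y x"
  shows "(\<Sum>x\<in>S. \<Sum>y\<in>S. f x y) = 0"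
proof -
  have "(\<Sum>x\<in>S. \<Sum>y\<in>S. f x y) = (\<Sum>x\<in>S. \<Sum>y\<in>S. - f y x)"
    by (intro sum.cong refl assms)
  also have "\<dots> = - (\<Sum>x\<in>S. \<Sum>y\<in>S. f x y)"
    by (subst sum.swap) (simp add: sum_negf)
  finally show ?thesis
    by simp
qed

lemma sum_symmetric_interval:
  fixes f :: "int \<Rightarrow> 'a :: comm_monoid_add"
  shows "(\<Sum>j = - int k..int k. f j) = f 0 + (\<Sum>i=1..k. f (int i) + f (- int i))"
proof (induction k)
  case (Suc k)
  have "{- int (Suc k)..int (Suc k)} = insert (int (Suc k)) (insert (- int (Suc k)) {- int k..int k})"
    by auto
  then show ?case
    using Suc by (simp add: ac_simps)
qed simp

text \<open>The two bounds are proved together: peeling off \<open>a 0\<close> leaves minus the sum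
  of the shifted sequence, so each bound follows from the opposite one for the shift.\<close>

lemma alternating_sum_bounds:
  fixes a :: "nat \<Rightarrow> int"
  assumes "\<And>i. a (Suc i) \<le> a i" "\<And>i. 0 \<le> a i"
  shows "0 \<le> (\<Sum>i<n. (-1) ^ i * a i) \<and> (\<Sum>i<n. (-1) ^ i * a i) \<le> a 0"
  using assms
proof (induction n arbitrary: a)
  case (Suc n)
  have "(\<Sum>i<Suc n. (-1) ^ i * a i) = a 0 - (\<Sum>i<n. (-1) ^ i * a (Suc i))"
    unfolding sum.lessThan_Suc_shift by (simp add: sum_negf)
  moreover have "0 \<le> (\<Sum>i<n. (-1) ^ i * a (Suc i)) \<and> (\<Sum>i<n. (-1) ^ i * a (Suc i)) \<le> a (Suc 0)"
    using Suc.prems by (intro Suc.IH)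
  ultimately show ?case
    using Suc.prems(1)[of 0] by linarith
qed simp

text \<open>The tail starts at index \<open>k + 1\<close>, which has the parity of
  \<open>k - 1\<close>, so the prefactor makes its leading sign positive.\<close>

lemma alternating_tail_nonneg:
  fixes a :: "nat \<Rightarrow> int"
  assumes "k > 0" and anti: "\<And>i. k < i \<Longrightarrow> a (Suc i) \<le> a i" and nonneg: "\<And>i. 0 \<le> a i"
  shows "0 \<le> (-1) ^ (k - 1) * ((\<Sum>i=1..n + k. (-1) ^ i * a i) - (\<Sum>i=1..k. (-1) ^ i * a i))"
proof -
  have eq: "{1..n + k} = {1..k} \<union> {Suc k..<n + Suc k}"
    by auto
  have "(\<Sum>i=1..n + k. (-1) ^ i * a i) =
      (\<Sum>i=1..k. (-1) ^ i * a i) + (\<Sum>i\<in>{Suc k..<n + Suc k}. (-1) ^ i * a i)"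
    unfolding eq by (rule sum.union_disjoint) auto
  also have "(\<Sum>i\<in>{Suc k..<n + Suc k}. (-1) ^ i * a i) = (\<Sum>i<n. (-1) ^ (i + Suc k) * a (i + Suc k))"
    using sum.shift_bounds_nat_ivl[of "\<lambda>i. (-1) ^ i * a i" 0 "Suc k" n]
    by (simp only: atLeast0LessThan add_0)
  finally have diff: "(\<Sum>i=1..n + k. (-1) ^ i * a i) - (\<Sum>i=1..k. (-1) ^ i * a i) =
      (\<Sum>i<n. (-1) ^ (i + Suc k) * a (i + Suc k))"
    by simp
  have ev: "even (k - 1 + (i + Suc k)) = even i" for i
    using assms(1) by auto
  have "(-1 :: int) ^ (k - 1) * (-1) ^ (i + Suc k) = (-1) ^ i" for i
    unfolding power_add[symmetric] unfolding minus_one_power_iff ev ..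
  then have "(-1) ^ (k - 1) * (\<Sum>i<n. (-1) ^ (i + Suc k) * a (i + Suc k)) =
      (\<Sum>i<n. (-1) ^ i * a (i + Suc k))"
    by (simp only: sum_distrib_left mult.assoc[symmetric])
  moreover have "0 \<le> (\<Sum>i<n. (-1) ^ i * a (i + Suc k))"
  proof (rule alternating_sum_bounds[THEN conjunct1])
    show "a (Suc i + Suc k) \<le> a (i + Suc k)" for i
      using anti[of "i + Suc k"] by simp
  qed (rule nonneg)
  ultimately show ?thesis
    unfolding diff by simp
qed

section \<open>Pentagonal numbers\<close>

text \<open>Defined as a sum, so that exponents involve no division and unfold by recursion.\<close>

definition tri :: "nat \<Rightarrow> nat" where
  "tri j = (\<Sum>i\<le>j. i)"

lemma tri_0 [simp]: "tri 0 = 0"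
  by (simp add: tri_def)

lemma tri_Suc [simp]: "tri (Suc j) = tri j + Suc j"
  by (simp add: tri_def)

text \<open>The exponents \<open>j(3j - 1)/2\<close> for \<open>j = i\<close> and \<open>j = -i\<close>.\<close>

definition pent :: "nat \<Rightarrow> nat" where
  "pent i = i * i + tri (i - 1)"

definition pent_neg :: "nat \<Rightarrow> nat" where
  "pent_neg i = i * i + tri i"

lemma tri_double: "2 * tri j = j * (j + 1)"
  by (induction j) simp_all

lemma pent_int: "int i * (3 * int i - 1) div 2 = int (pent i)"
proof (cases i)
  case (Suc k)
  have "2 * int (tri k) = int k * (int k + 1)"
    using arg_cong[OF tri_double[of k], of int] by (simp add: algebra_simps)
  then have "int i * (3 * int i - 1) = 2 * int (pent i)"
    by (simp add: Suc pent_def algebra_simps)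
  then show ?thesis
    by simp
qed (simp add: pent_def)

lemma pent_neg_int: "- int i * (3 * (- int i) - 1) div 2 = int (pent_neg i)"
proof -
  have "2 * int (tri i) = int i * (int i + 1)"
    using arg_cong[OF tri_double[of i], of int] by (simp add: algebra_simps)
  then have "- int i * (3 * (- int i) - 1) = 2 * int (pent_neg i)"
    by (simp add: pent_neg_def algebra_simps)
  then show ?thesis
    by (metis nonzero_mult_div_cancel_left zero_neq_numeral)
qed

lemma pent_Suc: "i > 0 \<Longrightarrow> pent (Suc i) = pent i + (3 * i + 1)"
  by (cases i) (simp_all add: pent_def)

lemma pent_neg_Suc: "pent_neg (Suc i) = pent_neg i + (3 * i + 2)"
  by (simp add: pent_neg_def)

section \<open>Generating functions\<close>

definition gf :: "'a set \<Rightarrow> ('a \<Rightarrow> nat) \<Rightarrow> int fps" where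
  "gf S wt = Abs_fps (\<lambda>n. int (card {x \<in> S. wt x = n}))"

text \<open>\<open>card\<close> sends infinite sets to 0, so the sum and product rules for
  \<open>gf\<close> ask for this condition.\<close>

definition fin_fibres :: "'a set \<Rightarrow> ('a \<Rightarrow> nat) \<Rightarrow> bool" where
  "fin_fibres S wt \<longleftrightarrow> (\<forall>n. finite {x \<in> S. wt x = n})"

lemma gf_nth: "gf S wt $ n = int (card {x \<in> S. wt x = n})"
  by (simp add: gf_def)

lemma fin_fibresD: "fin_fibres S wt \<Longrightarrow> finite {x \<in> S. wt x = n}"
  by (simp add: fin_fibres_def)

lemma fin_fibres_subset: "fin_fibres T wt \<Longrightarrow> S \<subseteq> T \<Longrightarrow> fin_fibres S wt"
  unfolding fin_fibres_def by (auto intro: rev_finite_subset)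

lemma gf_Un:
  assumes "fin_fibres S wt" "fin_fibres T wt" "S \<inter> T = {}"
  shows "gf (S \<union> T) wt = gf S wt + gf T wt"
proof (rule fps_ext)
  fix n
  have "{x \<in> S \<union> T. wt x = n} = {x \<in> S. wt x = n} \<union> {x \<in> T. wt x = n}"
    by auto
  moreover have "{x \<in> S. wt x = n} \<inter> {x \<in> T. wt x = n} = {}"
    using assms(3) by auto
  ultimately show "gf (S \<union> T) wt $ n = (gf S wt + gf T wt) $ n"
    using assms by (simp add: gf_nth card_Un_disjoint fin_fibresD)
qed

text \<open>A fibre of \<open>V\<close> is the disjoint union, over the weight of the first
  component, of products of fibres: the Cauchy product. The offset \<open>c\<close> is the weight
  that \<open>h\<close> adds to every pair.\<close>

lemma gf_prod:
  assumes h: "bij_betw h (S \<times> T) V"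
    and wt: "\<And>x y. x \<in> S \<Longrightarrow> y \<in> T \<Longrightarrow> wv (h (x, y)) = c + ws x + wt y"
    and fin: "fin_fibres S ws" "fin_fibres T wt"
  shows "gf V wv = fps_X ^ c * (gf S ws * gf T wt)"
proof (rule fps_ext)
  fix n
  have inj: "inj_on h (S \<times> T)" and img: "h ` (S \<times> T) = V"
    using h by (auto simp: bij_betw_def)
  show "gf V wv $ n = (fps_X ^ c * (gf S ws * gf T wt)) $ n"
  proof (cases "n < c")
    case True
    have "{v \<in> V. wv v = n} = {}"
      unfolding img[symmetric] using True wt by auto
    then show ?thesis
      using True by (simp only: gf_nth fps_X_power_mult_nth) simp
  next
    case False
    define D where "D i = {x \<in> S. ws x = i} \<times> {y \<in> T. wt y = n - c - i}" for i
    have "{v \<in> V. wv v = n} = h ` (\<Union>i\<in>{0..n - c}. D i)"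
    proof
      show "{v \<in> V. wv v = n} \<subseteq> h ` (\<Union>i\<in>{0..n - c}. D i)"
      proof
        fix v
        assume "v \<in> {v \<in> V. wv v = n}"
        then obtain x y where xy: "x \<in> S" "y \<in> T" "v = h (x, y)" and "wv v = n"
          unfolding img[symmetric] by auto
        then have "(x, y) \<in> D (ws x)" "ws x \<in> {0..n - c}"
          using wt[OF xy(1,2)] by (auto simp: D_def)
        then show "v \<in> h ` (\<Union>i\<in>{0..n - c}. D i)"
          using xy(3) by blast
      qed
      show "h ` (\<Union>i\<in>{0..n - c}. D i) \<subseteq> {v \<in> V. wv v = n}"
        unfolding img[symmetric] D_def using wt False by auto
    qed
    moreover have "inj_on h (\<Union>i\<in>{0..n - c}. D i)"
      using inj by (rule inj_on_subset) (auto simp: D_def)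
    ultimately have "card {v \<in> V. wv v = n} = card (\<Union>i\<in>{0..n - c}. D i)"
      by (simp add: card_image)
    also have "\<dots> = (\<Sum>i\<in>{0..n - c}. card (D i))"
    proof (rule card_UN_disjoint)
      show "\<forall>i\<in>{0..n - c}. finite (D i)"
        using fin by (simp add: D_def fin_fibresD)
    qed (auto simp: D_def)
    finally show ?thesis
      using False
      by (simp only: gf_nth fps_X_power_mult_nth if_False)
         (simp add: fps_mult_nth gf_nth D_def card_cartesian_product)
  qed
qed

lemma gf_shift:
  assumes "bij_betw h S V" and "\<And>x. x \<in> S \<Longrightarrow> wv (h x) = c + ws x" and "fin_fibres S ws"
  shows "gf V wv = fps_X ^ c * gf S ws"
proof -
  \<comment> \<open>A one-point factor of weight 0 reduces the claim to
    \<open>gf_prod\<close>.\<close>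
  have *: "gf {()} (\<lambda>_. 0) = 1"
    by (rule fps_ext) (simp add: gf_nth)
  have "bij_betw (\<lambda>(x, y). h x) (S \<times> {()}) V"
    using assms(1) by (auto simp: bij_betw_def inj_on_def image_iff)
  then have "gf V wv = fps_X ^ c * (gf S ws * gf {()} (\<lambda>_. 0))"
    by (rule gf_prod) (use assms in \<open>auto simp: fin_fibres_def\<close>)
  then show ?thesis
    by (simp add: *)
qed

section \<open>Partitions with restricted parts\<close>

lemma size_le_sum_mset:
  fixes p :: "nat multiset"
  shows "\<forall>x\<in>#p. 0 < x \<Longrightarrow> size p \<le> sum_mset p"
  by (induction p) auto

text \<open>Positive parts with sum \<open>n\<close> are at most \<open>n\<close> in size and in
  number. Finiteness for the other families of multisets follows by inclusion.\<close>

lemma fin_fibres_positive: "fin_fibres {p :: nat multiset. \<forall>x\<in>#p. 0 < x} sum_mset"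
  unfolding fin_fibres_def
proof
  fix n
  have "{p \<in> {p. \<forall>x\<in>#p. 0 < x}. sum_mset p = n} \<subseteq> mset ` {xs. set xs \<subseteq> {..n} \<and> length xs \<le> n}"
  proof
    fix p :: "nat multiset"
    assume p: "p \<in> {p \<in> {p. \<forall>x\<in>#p. 0 < x}. sum_mset p = n}"
    obtain xs where xs: "p = mset xs"
      by (metis ex_mset)
    have "x \<le> n" if "x \<in># p" for x
      using p that by (auto simp: sum_mset.remove)
    moreover have "length xs \<le> n"
      using size_le_sum_mset[of p] p xs by auto
    ultimately show "p \<in> mset ` {xs. set xs \<subseteq> {..n} \<and> length xs \<le> n}"
      using xs by auto
  qed
  moreover have "finite (mset ` {xs. set xs \<subseteq> {..n} \<and> length xs \<le> n})"
    by (intro finite_imageI finite_lists_length_le) simp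
  ultimately show "finite {p \<in> {p. \<forall>x\<in>#p. 0 < x}. sum_mset p = n}"
    by (rule finite_subset)
qed

definition with_parts :: "nat set \<Rightarrow> nat multiset set" where
  "with_parts I = {p. set_mset p \<subseteq> I}"

abbreviation pgf :: "nat set \<Rightarrow> int fps" where
  "pgf I \<equiv> gf (with_parts I) sum_mset"

lemma fin_fibres_with_parts:
  assumes "0 \<notin> I"
  shows "fin_fibres (with_parts I) sum_mset"
proof (rule fin_fibres_subset[OF fin_fibres_positive], clarify)
  fix p x
  assume "p \<in> with_parts I" "x \<in># p"
  then have "x \<in> I"
    by (auto simp: with_parts_def)
  then show "0 < x"
    using assms by (cases x) auto
qed

lemma one_minus_mult_eqI:
  fixes x g :: "'a :: comm_ring_1"
  assumes "g = f + x * g"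
  shows "(1 - x) * g = f"
proof -
  have "(1 - x) * g = g - x * g"
    by (simp add: left_diff_distrib)
  also have "\<dots> = f"
    by (subst (1) assms) simp
  finally show ?thesis .
qed

text \<open>Either \<open>a\<close> does not occur, or one copy of it can be removed. The geometric
  factor stands on the left as \<open>1 - fps_X ^ a\<close>, which avoids dividing series.\<close>

lemma pgf_insert:
  assumes "a \<notin> I" "0 \<notin> I" "a > 0"
  shows "(1 - fps_X ^ a) * pgf (insert a I) = pgf I"
proof -
  let ?S = "with_parts (insert a I)"
  have S: "?S = with_parts I \<union> add_mset a ` ?S"
  proof
    show "?S \<subseteq> with_parts I \<union> add_mset a ` ?S"
    proof
      fix p
      assume p: "p \<in> ?S"
      show "p \<in> with_parts I \<union> add_mset a ` ?S"
      proof (cases "a \<in># p")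
        case True
        then have "p = add_mset a (p - {#a#})"
          by simp
        moreover have "p - {#a#} \<in> ?S"
          using p by (auto simp: with_parts_def dest: in_diffD)
        ultimately show ?thesis
          by blast
      next
        case False
        then show ?thesis
          using p by (auto simp: with_parts_def)
      qed
    qed
  qed (auto simp: with_parts_def)
  have fin: "fin_fibres ?S sum_mset"
    using assms by (intro fin_fibres_with_parts) auto
  have "gf (add_mset a ` ?S) sum_mset = fps_X ^ a * pgf (insert a I)"
    by (rule gf_shift[where h = "add_mset a"]) (auto simp: fin bij_betw_def inj_on_def)
  moreover have "pgf (insert a I) = pgf I + gf (add_mset a ` ?S) sum_mset"
  proof (subst S, rule gf_Un)
    show "fin_fibres (with_parts I) sum_mset"
      by (rule fin_fibres_with_parts) fact
    show "fin_fibres (add_mset a ` ?S) sum_mset"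
      using fin by (rule fin_fibres_subset) (auto simp: with_parts_def)
    show "with_parts I \<inter> add_mset a ` ?S = {}"
      using assms by (auto simp: with_parts_def)
  qed
  ultimately show ?thesis
    by (intro one_minus_mult_eqI) simp
qed

text \<open>The reciprocal of \<open>qpoch N\<close>, by \<open>qpoch_mult_qinv\<close>; the
  combinatorial form makes it directly usable for counting.\<close>

definition qinv :: "nat \<Rightarrow> int fps" where
  "qinv N = pgf {1..N}"

definition qpoch :: "nat \<Rightarrow> int fps" where
  "qpoch N = (\<Prod>i=1..N. 1 - fps_X ^ i)"

lemma qpoch_0 [simp]: "qpoch 0 = 1"
  by (simp add: qpoch_def)

lemma qpoch_Suc: "qpoch (Suc N) = (1 - fps_X ^ Suc N) * qpoch N"
  by (simp add: qpoch_def)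

lemma pgf_empty [simp]: "pgf {} = 1"
proof (rule fps_ext)
  fix n
  have "{x \<in> with_parts {}. sum_mset x = n} = (if n = 0 then {{#}} else {})"
    by (auto simp: with_parts_def)
  then show "pgf {} $ n = 1 $ n"
    by (simp add: gf_nth)
qed

lemma qinv_0 [simp]: "qinv 0 = 1"
  by (simp add: qinv_def)

lemma qinv_Suc: "(1 - fps_X ^ Suc N) * qinv (Suc N) = qinv N"
  using pgf_insert[of "Suc N" "{1..N}"] by (simp add: qinv_def atLeastAtMostSuc_conv)

lemma qpoch_mult_qinv: "qpoch N * qinv N = 1"
proof (induction N)
  case 0
  then show ?case
    by simp
next
  case (Suc N)
  have "qpoch (Suc N) * qinv (Suc N) = qpoch N * ((1 - fps_X ^ Suc N) * qinv (Suc N))"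
    by (simp only: qpoch_Suc ac_simps)
  then show ?case
    by (simp only: qinv_Suc Suc)
qed

definition partitions_gf :: "int fps" where
  "partitions_gf = pgf {1..}"

text \<open>No part of a partition of \<open>n\<close> exceeds \<open>n\<close>, so the bound
  \<open>M\<close> is not felt.\<close>

lemma partitions_gf_nth: "n \<le> M \<Longrightarrow> qinv M $ n = partitions_gf $ n"
proof -
  assume "n \<le> M"
  then have "x \<in> with_parts {1..M} \<longleftrightarrow> x \<in> with_parts {1..}" if "sum_mset x = n" for x
    using that unfolding with_parts_def by (fastforce simp: sum_mset.remove)
  then have "{x \<in> with_parts {1..M}. sum_mset x = n} = {x \<in> with_parts {1..}. sum_mset x = n}"
    by blast
  then show ?thesis
    by (simp add: qinv_def partitions_gf_def gf_nth)
qed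

section \<open>Partitions with a prescribed number of parts\<close>

definition of_size_above :: "nat \<Rightarrow> nat \<Rightarrow> nat multiset set" where
  "of_size_above w s = {p. set_mset p \<subseteq> {w<..} \<and> size p = s}"

lemma fin_fibres_of_size_above: "fin_fibres (of_size_above w s) sum_mset"
  by (rule fin_fibres_subset[OF fin_fibres_positive]) (auto simp: of_size_above_def)

lemma one_minus_X_power_neq_0: "1 - fps_X ^ Suc n \<noteq> (0 :: int fps)"
proof
  assume "1 - fps_X ^ Suc n = (0 :: int fps)"
  then have "(1 - fps_X ^ Suc n) $ 0 = (0 :: int fps) $ 0"
    by metis
  then show False
    by simp
qed

text \<open>If the least admissible part \<open>Suc w\<close> occurs, one copy is removed. Otherwise
  1 is subtracted from each of the \<open>Suc s\<close> parts, which leads back to the same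
  family.\<close>

lemma gf_of_size_above_Suc:
  "(1 - fps_X ^ Suc s) * gf (of_size_above w (Suc s)) sum_mset =
     fps_X ^ Suc w * gf (of_size_above w s) sum_mset"
proof -
  let ?R = "\<lambda>w s. of_size_above w s"
  have S: "?R w (Suc s) = add_mset (Suc w) ` ?R w s \<union> ?R (Suc w) (Suc s)"
  proof
    show "?R w (Suc s) \<subseteq> add_mset (Suc w) ` ?R w s \<union> ?R (Suc w) (Suc s)"
    proof
      fix p
      assume p: "p \<in> ?R w (Suc s)"
      show "p \<in> add_mset (Suc w) ` ?R w s \<union> ?R (Suc w) (Suc s)"
      proof (cases "Suc w \<in># p")
        case True
        then have "p = add_mset (Suc w) (p - {#Suc w#})"
          by simp
        moreover have "p - {#Suc w#} \<in> ?R w s"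
          using p True by (auto simp: of_size_above_def size_Diff_singleton dest: in_diffD)
        ultimately show ?thesis
          by blast
      next
        case False
        then have "Suc w < x" if "x \<in># p" for x
          using p that by (auto simp: of_size_above_def intro!: Suc_lessI)
        then show ?thesis
          using p by (auto simp: of_size_above_def)
      qed
    qed
  qed (auto simp: of_size_above_def)
  have 1: "gf (add_mset (Suc w) ` ?R w s) sum_mset = fps_X ^ Suc w * gf (?R w s) sum_mset"
    by (rule gf_shift[where h = "add_mset (Suc w)"])
       (auto simp: fin_fibres_of_size_above bij_betw_def inj_on_def)
  have "sum_mset (image_mset Suc p) = size p + sum_mset p" for p
    by (induction p) auto
  moreover have "bij_betw (image_mset Suc) (?R w (Suc s)) (?R (Suc w) (Suc s))"
  proof (rule bij_betw_byWitness[where f' = "image_mset (\<lambda>x. x - 1)"])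
    show "\<forall>p\<in>?R (Suc w) (Suc s). image_mset Suc (image_mset (\<lambda>x. x - 1) p) = p"
    proof
      fix p
      assume "p \<in> ?R (Suc w) (Suc s)"
      then have "image_mset (\<lambda>x. Suc (x - 1)) p = image_mset id p"
        by (intro image_mset_cong) (auto simp: of_size_above_def)
      then show "image_mset Suc (image_mset (\<lambda>x. x - 1) p) = p"
        by (simp add: multiset.map_comp o_def)
    qed
    have "w < x - 1" if "Suc w < x" for x
      using that by simp
    then show "image_mset (\<lambda>x. x - 1) ` ?R (Suc w) (Suc s) \<subseteq> ?R w (Suc s)"
      by (auto simp: of_size_above_def subset_iff simp del: One_nat_def)
  qed (auto simp: of_size_above_def multiset.map_comp o_def)
  moreover have "\<And>p. p \<in> ?R w (Suc s) \<Longrightarrow> size p = Suc s"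
    by (simp add: of_size_above_def)
  ultimately have 2: "gf (?R (Suc w) (Suc s)) sum_mset = fps_X ^ Suc s * gf (?R w (Suc s)) sum_mset"
    by (intro gf_shift[where h = "image_mset Suc"])
       (simp_all add: fin_fibres_of_size_above)
  have "gf (?R w (Suc s)) sum_mset =
      gf (add_mset (Suc w) ` ?R w s) sum_mset + gf (?R (Suc w) (Suc s)) sum_mset"
  proof (subst S, rule gf_Un)
    show "fin_fibres (add_mset (Suc w) ` ?R w s) sum_mset"
      by (rule fin_fibres_subset[OF fin_fibres_of_size_above[of w "Suc s"]])
         (auto simp: of_size_above_def)
  qed (auto simp: of_size_above_def fin_fibres_of_size_above[unfolded of_size_above_def])
  then show ?thesis
    unfolding 1 2 by (rule one_minus_mult_eqI)
qed

text \<open>Bijectively: subtract \<open>Suc w\<close> from each part and conjugate. Here the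
  recurrence is solved by induction, cancelling the nonzero factor
  \<open>1 - fps_X ^ Suc s\<close>.\<close>

lemma gf_of_size_above: "gf (of_size_above w s) sum_mset = fps_X ^ (Suc w * s) * qinv s"
proof (induction s)
  case 0
  have "gf (of_size_above w 0) sum_mset = 1"
  proof (rule fps_ext)
    fix n
    have "{x \<in> of_size_above w 0. sum_mset x = n} = (if n = 0 then {{#}} else {})"
      by (auto simp: of_size_above_def)
    then show "gf (of_size_above w 0) sum_mset $ n = 1 $ n"
      by (simp add: gf_nth)
  qed
  then show ?case
    by simp
next
  case (Suc s)
  have "(1 - fps_X ^ Suc s) * gf (of_size_above w (Suc s)) sum_mset =
      fps_X ^ Suc w * (fps_X ^ (Suc w * s) * ((1 - fps_X ^ Suc s) * qinv (Suc s)))"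
    by (simp only: gf_of_size_above_Suc Suc qinv_Suc)
  also have "\<dots> = (1 - fps_X ^ Suc s) * (fps_X ^ (Suc w * Suc s) * qinv (Suc s))"
    by (simp add: power_add algebra_simps)
  finally show ?case
    using one_minus_X_power_neq_0 mult_left_cancel by blast
qed

section \<open>Infinite sums and products of power series\<close>

lemma fps_mult_nth_cong:
  "(\<And>i. i \<le> n \<Longrightarrow> f $ i = f' $ i) \<Longrightarrow> (\<And>i. i \<le> n \<Longrightarrow> g $ i = g' $ i) \<Longrightarrow>
    (f * g) $ n = (f' * g') $ n"
  by (simp add: fps_mult_nth)

lemma X_power_mult_nth_less [simp]: "n < k \<Longrightarrow> (fps_X ^ k * (f :: int fps)) $ n = 0"
  by (simp add: fps_X_power_mult_nth)

text \<open>The formal sum of a sequence whose \<open>N\<close>-th term is divisible by \<open>X\<^sup>N\<close>.\<close>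

definition fps_series :: "(nat \<Rightarrow> int fps) \<Rightarrow> int fps" where
  "fps_series t = Abs_fps (\<lambda>n. \<Sum>N\<le>n. t N $ n)"

lemma fps_series_nth:
  assumes "\<And>N i. i < N \<Longrightarrow> t N $ i = 0" and "n \<le> M"
  shows "fps_series t $ n = (\<Sum>N\<le>M. t N) $ n"
proof -
  have "(\<Sum>N\<le>M. t N $ n) = (\<Sum>N\<le>n. t N $ n)"
    using assms by (intro sum.mono_neutral_right) auto
  then show ?thesis
    by (simp add: fps_series_def fps_sum_nth)
qed

text \<open>Euler's product: factors beyond the \<open>n\<close>-th do not affect coefficient
  \<open>n\<close>.\<close>

definition qpoch_inf :: "int fps" where
  "qpoch_inf = Abs_fps (\<lambda>n. qpoch n $ n)"

lemma qpoch_inf_nth: "n \<le> M \<Longrightarrow> qpoch_inf $ n = qpoch M $ n"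
proof (induction M)
  case 0
  then show ?case
    by (simp add: qpoch_inf_def)
next
  case (Suc M)
  show ?case
  proof (cases "n = Suc M")
    case True
    then show ?thesis
      by (simp add: qpoch_inf_def)
  next
    case False
    then have "n < Suc M"
      using Suc.prems by simp
    then have "qpoch (Suc M) $ n = qpoch M $ n"
      by (simp add: qpoch_Suc left_diff_distrib del: power_Suc)
    then show ?thesis
      using Suc False by simp
  qed
qed

text \<open>The pattern for identities between infinite objects: fix a coefficient, replace each
  object by a finite truncation, and use the finite identity.\<close>

lemma qpoch_inf_mult_partitions_gf: "qpoch_inf * partitions_gf = 1"
proof (rule fps_ext)
  fix n
  have "(qpoch_inf * partitions_gf) $ n = (qpoch n * qinv n) $ n"
    by (intro fps_mult_nth_cong) (simp_all add: qpoch_inf_nth[of _ n] partitions_gf_nth[of _ n])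
  then show "(qpoch_inf * partitions_gf) $ n = 1 $ n"
    by (simp add: qpoch_mult_qinv)
qed

text \<open>The series \<open>U m\<close> for \<open>m > 0\<close>; for \<open>m = 0\<close> every
  term has constant coefficient 1, and the sum does not converge.\<close>

definition unimod_ser :: "nat \<Rightarrow> int fps" where
  "unimod_ser m = fps_series (\<lambda>N. fps_X ^ (m * N) * (qinv N * qinv N))"

lemma unimod_ser_nth:
  assumes "m > 0" "n \<le> M"
  shows "unimod_ser m $ n = (\<Sum>N\<le>M. fps_X ^ (m * N) * (qinv N * qinv N)) $ n"
  unfolding unimod_ser_def
proof (rule fps_series_nth[OF _ assms(2)])
  fix N i :: nat
  assume "i < N"
  also have "N \<le> m * N"
    using assms(1) by simp
  finally show "(fps_X ^ (m * N) * (qinv N * qinv N)) $ i = 0"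
    by simp
qed

text \<open>The sum on the other side of Heine's transformation. The parameter \<open>m\<close> is
  kept free in order to have a recurrence in it; \<open>m = 2\<close> belongs to crank 0.\<close>

definition crank_ser :: "nat \<Rightarrow> int fps" where
  "crank_ser m = fps_series (\<lambda>N. fps_X ^ (N * N + m * N) * (qinv N * qinv N))"

lemma crank_ser_nth:
  assumes "n \<le> M"
  shows "crank_ser m $ n = (\<Sum>N\<le>M. fps_X ^ (N * N + m * N) * (qinv N * qinv N)) $ n"
  unfolding crank_ser_def
proof (rule fps_series_nth[OF _ assms])
  fix N i :: nat
  assume "i < N"
  also have "N \<le> N * N + m * N"
    by (cases N) auto
  finally show "(fps_X ^ (N * N + m * N) * (qinv N * qinv N)) $ i = 0"
    by simp
qed

section \<open>The two series identities\<close>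

lemma qinv_square_Suc:
  "(1 - 2 * fps_X ^ Suc N + fps_X ^ (2 * Suc N)) * (qinv (Suc N) * qinv (Suc N)) = qinv N * qinv N"
proof -
  have "(1 - 2 * x + x * x) * (b * b) = (1 - x) * b * ((1 - x) * b)" for x b :: "int fps"
    by (simp add: algebra_simps)
  from this[of "fps_X ^ Suc N" "qinv (Suc N)"] show ?thesis
    unfolding qinv_Suc mult_2[of "Suc N"] power_add .
qed

text \<open>Since \<open>2x - x^2 = 1 - (1 - x)^2\<close>, for \<open>N > 0\<close> the
  \<open>N\<close>-th term is the difference of the squares of \<open>qinv N\<close> and
  \<open>qinv (N - 1)\<close>, and the sum telescopes.\<close>

lemma two_unimod_ser_1_minus_2: "2 * unimod_ser 1 - unimod_ser 2 = partitions_gf * partitions_gf"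
proof (rule fps_ext)
  fix n
  have *: "(\<Sum>N\<le>M. 2 * (fps_X ^ (1 * N) * (qinv N * qinv N)) - fps_X ^ (2 * N) * (qinv N * qinv N)) =
      qinv M * qinv M" for M
  proof (induction M)
    case 0
    then show ?case
      by simp
  next
    case (Suc M)
    show ?case
      unfolding sum.atMost_Suc Suc qinv_square_Suc[of M, symmetric]
      by (simp add: ring_distribs mult.assoc del: power_Suc)
  qed
  have "(2 * unimod_ser 1 - unimod_ser 2) $ n =
      2 * (\<Sum>N\<le>n. fps_X ^ (1 * N) * (qinv N * qinv N)) $ n - (\<Sum>N\<le>n. fps_X ^ (2 * N) * (qinv N * qinv N)) $ n"
    using unimod_ser_nth[of 1 n n] unimod_ser_nth[of 2 n n] by (simp add: numeral_fps_const)
  also have "\<dots> = (\<Sum>N\<le>n. 2 * (fps_X ^ (1 * N) * (qinv N * qinv N)) - fps_X ^ (2 * N) * (qinv N * qinv N)) $ n"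
    by (simp add: fps_sum_nth sum_subtractf sum_distrib_left numeral_fps_const)
  also have "\<dots> = (qinv n * qinv n) $ n"
    unfolding * ..
  also have "\<dots> = (partitions_gf * partitions_gf) $ n"
    by (intro fps_mult_nth_cong) (simp_all add: partitions_gf_nth)
  finally show "(2 * unimod_ser 1 - unimod_ser 2) $ n = (partitions_gf * partitions_gf) $ n" .
qed

lemma qpoch_inf_unimod_ser_1: "2 * (qpoch_inf * unimod_ser 1) = partitions_gf + qpoch_inf * unimod_ser 2"
proof -
  have "qpoch_inf * (2 * unimod_ser 1 - unimod_ser 2) = (qpoch_inf * partitions_gf) * partitions_gf"
    unfolding two_unimod_ser_1_minus_2 by simp
  then show ?thesis
    unfolding qpoch_inf_mult_partitions_gf by (simp add: algebra_simps)
qed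

lemma second_difference_factor:
  fixes a c x y :: "'a :: comm_ring_1"
  shows "a * c - 2 * (a * x * c) + a * y * c = a * ((1 - 2 * x + y) * c)"
  by (simp add: algebra_simps)

text \<open>The second difference in \<open>m\<close> multiplies the \<open>N\<close>-th term by
  \<open>(1 - q^N)^2\<close>. This kills \<open>N = 0\<close> and lowers the index of
  \<open>qinv\<close>; reindexing then releases the factor \<open>q^m\<close>.\<close>

lemma unimod_ser_rec:
  assumes "m > 0"
  shows "unimod_ser m - 2 * unimod_ser (m + 1) + unimod_ser (m + 2) = fps_X ^ m * unimod_ser m"
proof (rule fps_ext)
  fix n
  let ?t = "\<lambda>m N. fps_X ^ (m * N) * (qinv N * qinv N)"
  have 0: "?t m N - 2 * ?t (m + 1) N + ?t (m + 2) N =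
      fps_X ^ (m * N) * ((1 - 2 * fps_X ^ N + fps_X ^ (2 * N)) * (qinv N * qinv N))" for N
  proof -
    have e: "(m + 1) * N = m * N + N" "(m + 2) * N = m * N + 2 * N"
      by simp_all
    show ?thesis
      unfolding e power_add by (rule second_difference_factor)
  qed
  have "(\<Sum>N\<le>Suc n. ?t m N - 2 * ?t (m + 1) N + ?t (m + 2) N) = fps_X ^ m * (\<Sum>N\<le>n. ?t m N)"
    unfolding 0 by (subst sum.atMost_Suc_shift, simp only: qinv_square_Suc)
      (simp add: sum_distrib_left power_add algebra_simps)
  moreover have "(\<Sum>N\<le>Suc n. ?t m N - 2 * ?t (m + 1) N + ?t (m + 2) N) $ n =
      (unimod_ser m - 2 * unimod_ser (m + 1) + unimod_ser (m + 2)) $ n"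
    using assms
    by (simp add: unimod_ser_nth[of _ n "Suc n"] fps_sum_nth sum_subtractf sum.distrib
        sum_distrib_left numeral_fps_const)
  moreover have "(fps_X ^ m * (\<Sum>N\<le>n. ?t m N)) $ n = (fps_X ^ m * unimod_ser m) $ n"
    using assms by (intro fps_mult_nth_cong) (simp_all add: unimod_ser_nth[of _ _ n])
  ultimately show "(unimod_ser m - 2 * unimod_ser (m + 1) + unimod_ser (m + 2)) $ n = (fps_X ^ m * unimod_ser m) $ n"
    by simp
qed

text \<open>As for \<open>unimod_ser_rec\<close>, but reindexing the quadratic exponent also raises
  the parameter from \<open>m\<close> to \<open>m + 2\<close>.\<close>

lemma crank_ser_rec: "crank_ser m - 2 * crank_ser (m + 1) + crank_ser (m + 2) = fps_X ^ (m + 1) * crank_ser (m + 2)"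
proof (rule fps_ext)
  fix n
  let ?t = "\<lambda>m N. fps_X ^ (N * N + m * N) * (qinv N * qinv N)"
  have 0: "?t m N - 2 * ?t (m + 1) N + ?t (m + 2) N =
      fps_X ^ (N * N + m * N) * ((1 - 2 * fps_X ^ N + fps_X ^ (2 * N)) * (qinv N * qinv N))" for N
  proof -
    have e: "N * N + (m + 1) * N = (N * N + m * N) + N" "N * N + (m + 2) * N = (N * N + m * N) + 2 * N"
      by simp_all
    show ?thesis
      unfolding e power_add[of _ "N * N + m * N"] by (rule second_difference_factor)
  qed
  have e: "Suc N * Suc N + m * Suc N = m + 1 + (N * N + (m + 2) * N)" for N
    by simp
  have "(\<Sum>N\<le>Suc n. ?t m N - 2 * ?t (m + 1) N + ?t (m + 2) N) =
      fps_X ^ (m + 1) * (\<Sum>N\<le>n. ?t (m + 2) N)"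
    unfolding 0 sum.atMost_Suc_shift qinv_square_Suc e power_add[of _ "m + 1"]
    by (simp add: sum_distrib_left mult.assoc)
  moreover have "(\<Sum>N\<le>Suc n. ?t m N - 2 * ?t (m + 1) N + ?t (m + 2) N) $ n =
      (crank_ser m - 2 * crank_ser (m + 1) + crank_ser (m + 2)) $ n"
    by (simp add: crank_ser_nth[of n "Suc n"] fps_sum_nth sum_subtractf sum.distrib
        sum_distrib_left numeral_fps_const)
  moreover have "(fps_X ^ (m + 1) * (\<Sum>N\<le>n. ?t (m + 2) N)) $ n = (fps_X ^ (m + 1) * crank_ser (m + 2)) $ n"
    by (intro fps_mult_nth_cong) (simp_all add: crank_ser_nth[of _ n])
  ultimately show "(crank_ser m - 2 * crank_ser (m + 1) + crank_ser (m + 2)) $ n = (fps_X ^ (m + 1) * crank_ser (m + 2)) $ n"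
    by simp
qed

section \<open>Heine's transformation through a recurrence with a unique solution\<close>

lemma unimod_ser_nth_small: "n < m \<Longrightarrow> unimod_ser m $ n = 1 $ n"
proof -
  assume nm: "n < m"
  have "(fps_X ^ (m * Suc N) * (qinv (Suc N) * qinv (Suc N))) $ n = 0" for N
    using nm by (intro X_power_mult_nth_less) (simp add: trans_less_add1)
  then show ?thesis
    using nm by (simp add: unimod_ser_nth[of m n "Suc n"] sum.atMost_Suc_shift fps_sum_nth del: sum.atMost_Suc)
qed

text \<open>The terms with \<open>N > 0\<close> start in degree at least \<open>m + 1\<close>, one
  later than those of \<open>unimod_ser m\<close>.\<close>

lemma crank_ser_nth_small: "n \<le> m \<Longrightarrow> crank_ser m $ n = 1 $ n"
proof -
  assume nm: "n \<le> m"
  have "(fps_X ^ (Suc N * Suc N + m * Suc N) * (qinv (Suc N) * qinv (Suc N))) $ n = 0" for N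
    using nm by (intro X_power_mult_nth_less) (simp add: trans_less_add1)
  then show ?thesis
    by (simp add: crank_ser_nth[of n "Suc n"] sum.atMost_Suc_shift fps_sum_nth del: sum.atMost_Suc)
qed

text \<open>The multiplier \<open>qpoch_inf * qinv m\<close> is the product of the factors
  \<open>1 - q^i\<close> with \<open>i > m\<close>. It turns the recurrence of
  \<open>unimod_ser\<close> into the one of \<open>crank_ser\<close>.\<close>

definition heine :: "nat \<Rightarrow> int fps" where
  "heine m = qpoch_inf * qinv m * unimod_ser (m + 1)"

text \<open>Passing from \<open>qinv m\<close> to \<open>qinv (m + 1)\<close> supplies the factor
  that \<open>unimod_ser_rec\<close> has at \<open>unimod_ser (m + 1)\<close>; a second such passage
  gives the factor at \<open>heine (m + 2)\<close>.\<close>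

lemma heine_rec: "heine m = 2 * heine (m + 1) - (1 - fps_X ^ (m + 2)) * heine (m + 2)"
proof -
  have s: "(1 - fps_X ^ (m + 1)) * unimod_ser (m + 1) = 2 * unimod_ser (m + 2) - unimod_ser (m + 3)"
    using unimod_ser_rec[of "m + 1"] by (simp add: algebra_simps eval_nat_numeral)
  have i: "qinv m = (1 - fps_X ^ (m + 1)) * qinv (m + 1)"
    "qinv (m + 1) = (1 - fps_X ^ (m + 2)) * qinv (m + 2)"
    using qinv_Suc[of m] qinv_Suc[of "m + 1"] by simp_all
  have "heine m = qpoch_inf * qinv (m + 1) * ((1 - fps_X ^ (m + 1)) * unimod_ser (m + 1))"
    unfolding heine_def i(1) by (simp only: ac_simps)
  also have "\<dots> = 2 * (qpoch_inf * qinv (m + 1) * unimod_ser (m + 2)) - qpoch_inf * qinv (m + 1) * unimod_ser (m + 3)"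
    unfolding s by (simp add: algebra_simps)
  also have "qpoch_inf * qinv (m + 1) * unimod_ser (m + 3) = (1 - fps_X ^ (m + 2)) * heine (m + 2)"
    unfolding heine_def i(2) by (simp add: ac_simps eval_nat_numeral)
  finally show ?thesis
    by (simp add: heine_def eval_nat_numeral)
qed

lemma heine_nth_small: "n \<le> m \<Longrightarrow> heine m $ n = 1 $ n"
proof -
  assume nm: "n \<le> m"
  have "heine m $ n = ((qpoch m * qinv m) * 1) $ n"
    unfolding heine_def using nm
    by (intro fps_mult_nth_cong)
       (simp_all add: qpoch_inf_nth[of _ m] unimod_ser_nth_small)
  then show ?thesis
    by (simp only: qpoch_mult_qinv mult_1_right)
qed

text \<open>The recurrence for the differences \<open>d m - d (m + 1)\<close> involves only lower coefficients of \<open>d\<close>,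
  so a coefficient which vanishes for large \<open>m\<close> vanishes for all \<open>m\<close>.\<close>

lemma recurrence_unique:
  fixes d :: "nat \<Rightarrow> int fps"
  assumes rec: "\<And>m. d m = 2 * d (m + 1) - (1 - fps_X ^ (m + 2)) * d (m + 2)"
    and small: "\<And>m n. n \<le> m \<Longrightarrow> d m $ n = 0"
  shows "d m = 0"
proof -
  have "\<forall>m. d m $ n = 0" for n
  proof (induction n rule: less_induct)
    case (less n)
    have e: "d m $ n - d (m + 1) $ n = d (m + 1) $ n - d (m + 2) $ n" for m
    proof -
      have "(fps_X ^ (m + 2) * d (m + 2)) $ n = 0"
        using less by (simp only: fps_X_power_mult_nth) auto
      moreover have "d m $ n = 2 * d (m + 1) $ n - d (m + 2) $ n + (fps_X ^ (m + 2) * d (m + 2)) $ n"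
        by (subst rec) (simp add: numeral_fps_const algebra_simps)
      ultimately show ?thesis
        by simp
    qed
    have const: "d m $ n = d (m + 1) $ n" for m
    proof -
      have "d m $ n - d (m + 1) $ n = d (m + i) $ n - d (m + i + 1) $ n" for i
      proof (induction i)
        case (Suc i)
        then show ?case
          using e[of "m + i"] by simp
      qed simp
      from this[of n] show ?thesis
        using small by simp
    qed
    have "d m $ n = d (m + i) $ n" for i m
    proof (induction i)
      case (Suc i)
      then show ?case
        using const[of "m + i"] by simp
    qed simp
    from this[of _ n] show ?case
      using small by simp
  qed
  then show ?thesis
    by (intro fps_ext) simp
qed

text \<open>Both sides satisfy the same linear recurrence and agree with 1 up to degree
  \<open>m\<close>, so \<open>recurrence_unique\<close> applies to their difference.\<close>

lemma heine_eq_crank_ser: "heine m = crank_ser (m + 1)"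
proof -
  define d where "d m = heine m - crank_ser (m + 1)" for m
  have "d m = 0"
  proof (rule recurrence_unique)
    fix m
    have r: "crank_ser (m + 1) = 2 * crank_ser (m + 2) - (1 - fps_X ^ (m + 2)) * crank_ser (m + 3)"
      using crank_ser_rec[of "m + 1"] by (simp add: algebra_simps eval_nat_numeral)
    show "d m = 2 * d (m + 1) - (1 - fps_X ^ (m + 2)) * d (m + 2)"
      unfolding d_def heine_rec[of m] r by (simp add: algebra_simps eval_nat_numeral)
  qed (simp add: d_def heine_nth_small crank_ser_nth_small)
  then show ?thesis
    by (simp add: d_def)
qed

lemma qpoch_inf_unimod_ser_2: "qpoch_inf * unimod_ser 2 = (1 - fps_X) * crank_ser 2"
proof -
  have "(1 - fps_X) * crank_ser 2 = qpoch_inf * ((1 - fps_X ^ Suc 0) * qinv (Suc 0)) * unimod_ser 2"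
    using heine_eq_crank_ser[of 1] by (simp add: heine_def ac_simps numeral_2_eq_2)
  then show ?thesis
    unfolding qinv_Suc by simp
qed

section \<open>The pentagonal number theorem\<close>

text \<open>Shanks' finite form of the pentagonal number theorem. Raising \<open>k\<close> changes
  the terms by a telescoping amount, whose end yields \<open>pent (Suc k)\<close>; the new last term
  yields \<open>pent_neg (Suc k)\<close>.\<close>

lemma shanks:
  "(\<Sum>j\<le>k. (-1) ^ j * (qpoch k * qinv j * fps_X ^ (j * k + tri j))) =
    1 + (\<Sum>i=1..k. (-1) ^ i * (fps_X ^ pent i + fps_X ^ pent_neg i))"
proof (induction k)
  case 0
  then show ?case
    by simp
next
  case (Suc k)
  define T where "T k j = (-1) ^ j * (qpoch k * qinv j * fps_X ^ (j * k + tri j))" for k j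
  \<comment> \<open>\<open>G\<close> is the telescoping certificate; its factor
    \<open>1 - fps_X ^ j\<close> makes \<open>G 0 = 0\<close>.\<close>
  define G where "G j = (-1) ^ j * (qpoch k * ((1 - fps_X ^ j) * qinv j) * fps_X ^ (j * k + tri j))" for j
  have G_Suc: "G (Suc j) = (-1) ^ Suc j * (qpoch k * qinv j * fps_X ^ (Suc j * k + tri (Suc j)))" for j
    unfolding G_def qinv_Suc ..
  have step: "T (Suc k) j = T k j + (G (Suc j) - G j)" for j
  proof -
    have e: "j * Suc k + tri j = (j * k + tri j) + j"
      "Suc j * k + tri (Suc j) = (j * k + tri j) + (j + Suc k)"
      by simp_all
    have *: "(1 - y) * x - 1 = - (x * y) - (1 - x)" for x y :: "int fps"
      by (simp add: algebra_simps)
    have "T (Suc k) j - T k j = (-1) ^ j * (qpoch k * qinv j * fps_X ^ (j * k + tri j)) *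
        ((1 - fps_X ^ Suc k) * fps_X ^ j - 1)"
      unfolding T_def qpoch_Suc e power_add[of _ "j * k + tri j"] by (simp add: algebra_simps del: power_Suc)
    also have "\<dots> = G (Suc j) - G j"
      unfolding * G_Suc unfolding G_def e power_add[of _ "j * k + tri j"] power_add[of _ j]
      by (simp add: algebra_simps)
    finally show ?thesis
      by (simp add: algebra_simps)
  qed
  have "(\<Sum>j\<le>k. G (Suc j) - G j) = G (Suc k)"
    using sum_lessThan_telescope[of G "Suc k"] by (simp add: lessThan_Suc_atMost G_def)
  also have "\<dots> = (-1) ^ Suc k * fps_X ^ pent (Suc k)"
    unfolding G_Suc qpoch_mult_qinv pent_def by (simp add: ac_simps)
  finally have tele: "(\<Sum>j\<le>k. G (Suc j) - G j) = (-1) ^ Suc k * fps_X ^ pent (Suc k)" .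
  have last: "T (Suc k) (Suc k) = (-1) ^ Suc k * fps_X ^ pent_neg (Suc k)"
    unfolding T_def qpoch_mult_qinv pent_neg_def by simp
  have "(\<Sum>j\<le>Suc k. T (Suc k) j) = (\<Sum>j\<le>k. T k j) + (\<Sum>j\<le>k. G (Suc j) - G j) + T (Suc k) (Suc k)"
    by (simp add: step sum.distrib)
  then show ?case
    using Suc unfolding tele last by (simp add: T_def[abs_def] distrib_left)
qed

text \<open>On the left of \<open>shanks\<close>, the terms with \<open>j > 0\<close> start beyond
  degree \<open>K\<close>, so only \<open>qpoch K\<close> is visible.\<close>

lemma qpoch_inf_pentagonal_nth:
  assumes "n \<le> K"
  shows "qpoch_inf $ n = (1 + (\<Sum>i=1..K. (-1) ^ i * (fps_X ^ pent i + fps_X ^ pent_neg i))) $ n"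
proof -
  have 0: "((-1) ^ Suc j * (qpoch K * qinv (Suc j) * fps_X ^ (Suc j * K + tri (Suc j)))) $ n = 0" for j
  proof -
    have "n < Suc j * K + tri (Suc j)"
      using assms by (simp add: trans_le_add1 less_Suc_eq_le)
    then have "(fps_X ^ (Suc j * K + tri (Suc j)) * ((-1) ^ Suc j * (qpoch K * qinv (Suc j)))) $ n = 0"
      by (rule X_power_mult_nth_less)
    then show ?thesis
      by (simp only: ac_simps)
  qed
  \<comment> \<open>One extra term, itself invisible, lets the term \<open>j = 0\<close> be split
    off without a case distinction on \<open>K\<close>.\<close>
  have "(\<Sum>j\<le>Suc K. (-1) ^ j * (qpoch K * qinv j * fps_X ^ (j * K + tri j))) $ n = qpoch K $ n"
    unfolding sum.atMost_Suc_shift fps_add_nth fps_sum_nth 0 by simp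
  then have "(\<Sum>j\<le>K. (-1) ^ j * (qpoch K * qinv j * fps_X ^ (j * K + tri j))) $ n = qpoch K $ n"
    unfolding sum.atMost_Suc fps_add_nth 0 by simp
  then show ?thesis
    unfolding shanks using assms by (simp add: qpoch_inf_nth)
qed

text \<open>Any cutoff \<open>K \<ge> n\<close> is allowed, so the full sum can be made to contain
  the truncated one.\<close>

lemma qpoch_inf_mult_nth:
  assumes "n \<le> K"
  shows "(qpoch_inf * f) $ n =
    f $ n + (\<Sum>i=1..K. (-1) ^ i * ((fps_X ^ pent i * f) $ n + (fps_X ^ pent_neg i * f) $ n))"
proof -
  have m1: "((-1) ^ i * g) $ n = (-1) ^ i * g $ n" for i and g :: "int fps"
    by (cases "even i") simp_all
  have "(qpoch_inf * f) $ n = ((1 + (\<Sum>i=1..K. (-1) ^ i * (fps_X ^ pent i + fps_X ^ pent_neg i))) * f) $ n"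
    using assms by (intro fps_mult_nth_cong qpoch_inf_pentagonal_nth) auto
  also have "\<dots> = f $ n + (\<Sum>i=1..K. (-1) ^ i * (fps_X ^ pent i * f + fps_X ^ pent_neg i * f)) $ n"
    by (simp add: distrib_right sum_distrib_right mult.assoc)
  finally show ?thesis
    by (simp add: fps_sum_nth m1)
qed

section \<open>Unimodal compositions\<close>

definition unimodal_max :: "nat \<Rightarrow> nat list set" where
  "unimodal_max M = {zs. unimodal zs \<and> (\<forall>x\<in>set zs. 0 < x) \<and> Max (set zs) = M}"

text \<open>The explicit \<open>M\<close> is meant to be the last maximal entry: \<open>A\<close>
  may contain further copies, \<open>B\<close> none. This makes the decomposition unique.\<close>

definition glue :: "nat \<Rightarrow> nat multiset \<times> nat multiset \<Rightarrow> nat list" where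
  "glue M = (\<lambda>(A, B). sorted_list_of_multiset A @ M # rev (sorted_list_of_multiset B))"

text \<open>The list is reversed so that the scan stops at the last \<open>M\<close>.\<close>

definition unglue :: "nat \<Rightarrow> nat list \<Rightarrow> nat multiset \<times> nat multiset" where
  "unglue M zs = (mset (tl (dropWhile (\<lambda>x. x \<noteq> M) (rev zs))), mset (takeWhile (\<lambda>x. x \<noteq> M) (rev zs)))"

lemma unglue_append: "M \<notin> set ys \<Longrightarrow> unglue M (xs @ M # ys) = (mset xs, mset ys)"
proof -
  assume M: "M \<notin> set ys"
  have "takeWhile (\<lambda>x. x \<noteq> M) (rev ys @ M # rev xs) = rev ys"
    using M by (subst takeWhile_append2) auto
  moreover have "dropWhile (\<lambda>x. x \<noteq> M) (rev ys @ M # rev xs) = M # rev xs"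
    using M by (subst dropWhile_append2) auto
  ultimately show ?thesis
    by (simp add: unglue_def)
qed

lemma sorted_before_last_max:
  assumes "unimodal (xs @ M # ys)" and max: "\<And>x. x \<in> set (xs @ M # ys) \<Longrightarrow> x \<le> M"
    and ys: "M \<notin> set ys"
  shows "sorted xs" "sorted (rev ys)"
proof -
  define zs where "zs = xs @ M # ys"
  obtain t where t: "t < length zs" "sorted (take (Suc t) zs)" "sorted_wrt (\<ge>) (drop t zs)"
    using assms(1) by (auto simp: unimodal_def zs_def)
  have inc: "zs ! i \<le> zs ! j" if "i \<le> j" "j \<le> t" for i j
    using sorted_nth_mono[OF t(2), of i j] that t(1) by simp
  have dec: "zs ! j \<le> zs ! i" if "t \<le> i" "i \<le> j" "j < length zs" for i j
  proof (cases "i = j")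
    case False
    then show ?thesis
      using sorted_wrt_nth_less[OF t(3), of "i - t" "j - t"] that by simp
  qed simp
  have len: "length xs < length zs"
    by (simp add: zs_def)
  have M: "zs ! length xs = M"
    by (simp add: zs_def)
  have "zs ! t = M"
  proof (rule antisym)
    show "zs ! t \<le> M"
      using max t(1) nth_mem unfolding zs_def by blast
    show "M \<le> zs ! t"
      using inc[of "length xs" t] dec[of t "length xs"] M t(1) len by (cases "length xs \<le> t") auto
  qed
  \<comment> \<open>The peak has the value \<open>M\<close>, so it cannot lie in
    \<open>ys\<close>.\<close>
  then have le: "t \<le> length xs"
    using ys t(1) by (auto simp: zs_def nth_append nth_Cons' not_le split: if_splits)
  have "zs ! i \<le> zs ! j" if "i \<le> j" "j < length xs" for i j
  proof (cases "j \<le> t")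
    case True
    then show ?thesis
      using inc that by simp
  next
    case False
    \<comment> \<open>Between the peak and the last maximum the entries descend to \<open>M\<close>,
      hence all equal it.\<close>
    then have "M \<le> zs ! j"
      using dec[of j "length xs"] that M len by simp
    moreover have "zs ! i \<le> M"
      using max[of "xs ! i"] that by (simp add: zs_def nth_append)
    ultimately show ?thesis
      by simp
  qed
  then show "sorted xs"
    unfolding sorted_iff_nth_mono by (simp add: zs_def nth_append)
  have "drop (Suc (length xs) - t) (drop t zs) = ys"
    using le by (simp add: zs_def Suc_diff_le)
  then show "sorted (rev ys)"
    using sorted_wrt_drop[OF t(3), of "Suc (length xs) - t"] by (simp add: sorted_wrt_rev)
qed

lemma bij_betw_glue:
  "bij_betw (glue (Suc N)) (with_parts {1..Suc N} \<times> with_parts {1..N}) (unimodal_max (Suc N))"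
proof (rule bij_betw_byWitness[where f' = "unglue (Suc N)"])
  let ?D = "with_parts {1..Suc N} \<times> with_parts {1..N}"
  show "\<forall>p\<in>?D. unglue (Suc N) (glue (Suc N) p) = p"
  proof clarify
    fix A B
    assume "B \<in> with_parts {1..N}"
    then have "Suc N \<notin># B"
      by (auto simp: with_parts_def)
    then show "unglue (Suc N) (glue (Suc N) (A, B)) = (A, B)"
      by (simp add: glue_def unglue_append)
  qed
  show "\<forall>zs\<in>unimodal_max (Suc N). glue (Suc N) (unglue (Suc N) zs) = zs"
    and "unglue (Suc N) ` unimodal_max (Suc N) \<subseteq> ?D"
  proof -
    have "glue (Suc N) (unglue (Suc N) zs) = zs \<and> unglue (Suc N) zs \<in> ?D"
      if zs: "zs \<in> unimodal_max (Suc N)" for zs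
    proof -
      have "zs \<noteq> []"
        using zs by (auto simp: unimodal_max_def unimodal_def)
      then have "Suc N \<in> set zs"
        using zs Max_in[of "set zs"] by (simp add: unimodal_max_def)
      then obtain xs ys where eq: "zs = xs @ Suc N # ys" "Suc N \<notin> set ys"
        using split_list_last by metis
      have le: "x \<le> Suc N" "0 < x" if "x \<in> set zs" for x
        using zs that Max_ge[of "set zs" x] by (auto simp: unimodal_max_def)
      have "sorted xs" "sorted (rev ys)"
        using sorted_before_last_max[of xs "Suc N" ys] zs le eq by (auto simp: unimodal_max_def)
      then have "sort xs = xs" "sort ys = rev ys"
        by (simp_all add: sorted_sort_id) (metis sorted_sort_id mset_rev sorted_list_of_multiset_mset)
      moreover have "mset xs \<in> with_parts {1..Suc N}" "mset ys \<in> with_parts {1..N}"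
        using le eq by (fastforce simp: with_parts_def le_Suc_eq Suc_le_eq)+
      ultimately show ?thesis
        using eq by (simp add: unglue_append glue_def)
    qed
    then show "\<forall>zs\<in>unimodal_max (Suc N). glue (Suc N) (unglue (Suc N) zs) = zs"
      and "unglue (Suc N) ` unimodal_max (Suc N) \<subseteq> ?D"
      by blast+
  qed
  show "glue (Suc N) ` ?D \<subseteq> unimodal_max (Suc N)"
  proof (clarify)
    fix A B
    assume AB: "A \<in> with_parts {1..Suc N}" "B \<in> with_parts {1..N}"
    let ?xs = "sorted_list_of_multiset A" and ?ys = "sorted_list_of_multiset B"
    have A: "\<And>x. x \<in># A \<Longrightarrow> 0 < x \<and> x \<le> Suc N" and B: "\<And>x. x \<in># B \<Longrightarrow> 0 < x \<and> x \<le> Suc N"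
      using AB by (fastforce simp: with_parts_def)+
    have "unimodal (glue (Suc N) (A, B))"
      unfolding unimodal_def
    proof (intro exI conjI)
      show "length ?xs < length (glue (Suc N) (A, B))"
        by (simp add: glue_def)
      show "sorted (take (Suc (length ?xs)) (glue (Suc N) (A, B)))"
        using A by (simp add: glue_def sorted_append)
      show "sorted_wrt (\<ge>) (drop (length ?xs) (glue (Suc N) (A, B)))"
        using B by (simp add: glue_def sorted_wrt_rev)
    qed
    moreover have "Max (set (glue (Suc N) (A, B))) = Suc N"
      by (rule Max_eqI) (use A B in \<open>auto simp: glue_def\<close>)
    ultimately show "glue (Suc N) (A, B) \<in> unimodal_max (Suc N)"
      using A B by (auto simp: unimodal_max_def glue_def)
  qed
qed

lemma sum_list_glue: "sum_list (glue M (A, B)) = M + sum_mset A + sum_mset B"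
  by (simp add: glue_def flip: sum_mset_sum_list)

lemma gf_unimodal_max:
  "gf (unimodal_max (Suc N)) sum_list = fps_X ^ Suc N * (qinv (Suc N) * qinv N)"
  unfolding qinv_def
  by (rule gf_prod[OF bij_betw_glue]) (simp_all add: sum_list_glue fin_fibres_with_parts)

lemma gf_with_parts_count:
  "gf {A \<in> with_parts {1..Suc N}. count A (Suc N) = k} sum_mset = fps_X ^ (k * Suc N) * qinv N"
  unfolding qinv_def
proof (rule gf_shift)
  show "bij_betw (\<lambda>A. A + replicate_mset k (Suc N)) (with_parts {1..N})
      {A \<in> with_parts {1..Suc N}. count A (Suc N) = k}"
  proof (rule bij_betw_byWitness[where f' = "filter_mset (\<lambda>x. x \<noteq> Suc N)"])
    show "\<forall>A\<in>with_parts {1..N}. filter_mset (\<lambda>x. x \<noteq> Suc N) (A + replicate_mset k (Suc N)) = A"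
    proof
      fix A
      assume "A \<in> with_parts {1..N}"
      then have "Suc N \<notin># A"
        by (auto simp: with_parts_def)
      then show "filter_mset (\<lambda>x. x \<noteq> Suc N) (A + replicate_mset k (Suc N)) = A"
        by (intro multiset_eqI) (simp add: not_in_iff)
    qed
    show "\<forall>A\<in>{A \<in> with_parts {1..Suc N}. count A (Suc N) = k}.
        filter_mset (\<lambda>x. x \<noteq> Suc N) A + replicate_mset k (Suc N) = A"
      by (auto intro!: multiset_eqI)
    show "(\<lambda>A. A + replicate_mset k (Suc N)) ` with_parts {1..N} \<subseteq>
        {A \<in> with_parts {1..Suc N}. count A (Suc N) = k}"
    proof clarify
      fix A
      assume A: "A \<in> with_parts {1..N}"
      then have "Suc N \<notin># A"
        by (auto simp: with_parts_def)
      then show "A + replicate_mset k (Suc N) \<in> with_parts {1..Suc N} \<and>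
          count (A + replicate_mset k (Suc N)) (Suc N) = k"
        using A by (fastforce simp: with_parts_def not_in_iff split: if_splits)
    qed
    show "filter_mset (\<lambda>x. x \<noteq> Suc N) ` {A \<in> with_parts {1..Suc N}. count A (Suc N) = k}
        \<subseteq> with_parts {1..N}"
      by (fastforce simp: with_parts_def le_Suc_eq)
  qed
qed (simp_all add: fin_fibres_with_parts)

text \<open>The explicit maximum counts once, so the other \<open>k\<close> copies are those in
  \<open>A\<close>.\<close>

lemma gf_unimodal_max_count:
  "gf {zs \<in> unimodal_max (Suc N). count_list zs (Suc N) = Suc k} sum_list =
     fps_X ^ (Suc k * Suc N) * (qinv N * qinv N)"
proof -
  let ?S = "{A \<in> with_parts {1..Suc N}. count A (Suc N) = k}"
  have count: "count_list (glue (Suc N) (A, B)) (Suc N) = Suc (count A (Suc N))"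
    if "B \<in> with_parts {1..N}" for A B
  proof -
    have "Suc N \<notin># B"
      using that by (auto simp: with_parts_def)
    then show ?thesis
      by (simp add: glue_def not_in_iff flip: count_mset)
  qed
  have inj: "inj_on (glue (Suc N)) (?S \<times> with_parts {1..N})"
    using bij_betw_imp_inj_on[OF bij_betw_glue] by (rule inj_on_subset) auto
  have "glue (Suc N) ` (?S \<times> with_parts {1..N}) =
      {zs \<in> unimodal_max (Suc N). count_list zs (Suc N) = Suc k}"
    unfolding bij_betw_imp_surj_on[OF bij_betw_glue, symmetric] using count by auto
  then have bij: "bij_betw (glue (Suc N)) (?S \<times> with_parts {1..N})
      {zs \<in> unimodal_max (Suc N). count_list zs (Suc N) = Suc k}"
    using inj by (simp add: bij_betw_def)
  have fin: "fin_fibres ?S sum_mset"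
    by (rule fin_fibres_subset[OF fin_fibres_with_parts[of "{1..Suc N}"]]) auto
  have "gf {zs \<in> unimodal_max (Suc N). count_list zs (Suc N) = Suc k} sum_list =
      fps_X ^ Suc N * (gf ?S sum_mset * pgf {1..N})"
    by (rule gf_prod[OF bij]) (simp_all add: sum_list_glue fin fin_fibres_with_parts del: One_nat_def)
  then show ?thesis
    unfolding gf_with_parts_count qinv_def[symmetric] by (simp add: power_add mult.assoc)
qed

lemma composition_eq_UN:
  "{zs. composition zs n \<and> unimodal zs \<and> Q zs} =
    (\<Union>N\<le>n. {zs \<in> {zs \<in> unimodal_max (Suc N). Q zs}. sum_list zs = n})"
proof -
  have "\<exists>N\<le>n. Max (set zs) = Suc N" if "composition zs n" "unimodal zs" for zs
  proof -
    have "zs \<noteq> []"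
      using that by (auto simp: unimodal_def)
    then have "Max (set zs) \<in> set zs"
      by simp
    then have "0 < Max (set zs)" "Max (set zs) \<le> n"
      using that member_le_sum_list[of "Max (set zs)" zs] by (auto simp: composition_def)
    then show ?thesis
      by (intro exI[of _ "Max (set zs) - 1"]) simp
  qed
  then show ?thesis
    by (fastforce simp: unimodal_max_def composition_def)
qed

lemma finite_compositions: "finite {zs. composition zs n}"
proof (rule finite_subset)
  show "{zs. composition zs n} \<subseteq> {xs. set xs \<subseteq> {..n} \<and> length xs \<le> n}"
  proof clarify
    fix zs
    assume zs: "composition zs n"
    then have "length zs \<le> n"
      using size_le_sum_mset[of "mset zs"] by (simp add: composition_def sum_mset_sum_list)
    then show "set zs \<subseteq> {..n} \<and> length zs \<le> n"
      using zs member_le_sum_list by (auto simp: composition_def)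
  qed
qed (intro finite_lists_length_le, simp)

lemma finite_compositions_conj: "finite {zs. composition zs n \<and> Q zs}"
  by (rule rev_finite_subset[OF finite_compositions[of n]]) auto

lemma card_compositions:
  "int (card {zs. composition zs n \<and> unimodal zs \<and> Q zs}) =
    (\<Sum>N\<le>n. gf {zs \<in> unimodal_max (Suc N). Q zs} sum_list $ n)"
proof -
  have "finite {zs. composition zs n \<and> unimodal zs \<and> Q zs}"
    by (rule finite_compositions_conj)
  then have "card (\<Union>N\<le>n. {zs \<in> {zs \<in> unimodal_max (Suc N). Q zs}. sum_list zs = n}) =
      (\<Sum>N\<le>n. card {zs \<in> {zs \<in> unimodal_max (Suc N). Q zs}. sum_list zs = n})"
    unfolding composition_eq_UN by (intro card_UN_disjoint) (auto simp: unimodal_max_def)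
  then show ?thesis
    unfolding composition_eq_UN gf_nth by simp
qed

lemma u_Suc_eq: "int (u (Suc k) (int n)) = unimod_ser (Suc k) $ n"
proof -
  let ?Q = "\<lambda>zs. count_list zs (Max (set zs)) = Suc k"
  have Q: "{zs \<in> unimodal_max (Suc N). ?Q zs} = {zs \<in> unimodal_max (Suc N). count_list zs (Suc N) = Suc k}" for N
    by (auto simp: unimodal_max_def)
  have "int (u (Suc k) (int n)) = int (card {zs. composition zs (n + Suc k) \<and> unimodal zs \<and> ?Q zs})"
    by (simp add: u_def)
  also have "\<dots> = (\<Sum>N\<le>n + Suc k. (fps_X ^ (Suc k * Suc N) * (qinv N * qinv N)) $ (n + Suc k))"
    unfolding card_compositions Q gf_unimodal_max_count ..
  \<comment> \<open>Compositions of \<open>n + m\<close> are counted by \<open>u m n\<close>; this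
    offset turns the exponent \<open>m(N + 1)\<close> for maximum \<open>N + 1\<close> into
    \<open>mN\<close>.\<close>
  also have "\<dots> = (\<Sum>N\<le>n + Suc k. (fps_X ^ (Suc k * N) * (qinv N * qinv N)) $ n)"
  proof (rule sum.cong)
    fix N
    have "(fps_X ^ (Suc k * Suc N) * (qinv N * qinv N)) $ (n + Suc k) =
        (fps_X ^ Suc k * (fps_X ^ (Suc k * N) * (qinv N * qinv N))) $ (n + Suc k)"
      by (simp add: power_add mult.assoc)
    also have "\<dots> = (fps_X ^ (Suc k * N) * (qinv N * qinv N)) $ n"
      by (simp only: fps_X_power_mult_nth) simp
    finally show "(fps_X ^ (Suc k * Suc N) * (qinv N * qinv N)) $ (n + Suc k) =
        (fps_X ^ (Suc k * N) * (qinv N * qinv N)) $ n" .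
  qed simp
  also have "\<dots> = unimod_ser (Suc k) $ n"
    by (subst unimod_ser_nth[of "Suc k" n "n + Suc k"]) (simp_all add: fps_sum_nth)
  finally show ?thesis .
qed

text \<open>With \<open>x = q^(N+1)\<close>, the factor \<open>x - x^2 = x(1 - x)\<close> lowers the
  index of one \<open>qinv\<close>, giving the count for maximum \<open>N + 1\<close> with free
  multiplicity. The terms for \<open>N = 0\<close> cancel, in accordance with
  \<open>u 0 0 = 0\<close>.\<close>

lemma u_0_eq: "int (u 0 (int n)) = (unimod_ser 1 - unimod_ser 2) $ n"
proof -
  have t: "fps_X ^ (1 * Suc N) * (qinv (Suc N) * qinv (Suc N)) - fps_X ^ (2 * Suc N) * (qinv (Suc N) * qinv (Suc N)) =
      fps_X ^ Suc N * (qinv (Suc N) * qinv N)" for N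
    unfolding qinv_Suc[of N, symmetric] mult_2 power_add by (simp add: algebra_simps del: power_Suc)
  have "(unimod_ser 1 - unimod_ser 2) $ n = (\<Sum>N\<le>Suc n. fps_X ^ (1 * N) * (qinv N * qinv N) - fps_X ^ (2 * N) * (qinv N * qinv N)) $ n"
    using unimod_ser_nth[of 1 n "Suc n"] unimod_ser_nth[of 2 n "Suc n"] by (simp add: fps_sum_nth sum_subtractf)
  also have "\<dots> = (\<Sum>N\<le>n. (fps_X ^ Suc N * (qinv (Suc N) * qinv N)) $ n)"
    unfolding sum.atMost_Suc_shift t by (simp add: fps_sum_nth)
  finally have unimod_ser: "(unimod_ser 1 - unimod_ser 2) $ n = (\<Sum>N\<le>n. (fps_X ^ Suc N * (qinv (Suc N) * qinv N)) $ n)" .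
  show ?thesis
  proof (cases "n = 0")
    case True
    then show ?thesis
      unfolding unimod_ser by (simp add: u_def)
  next
    case False
    then show ?thesis
      using card_compositions[of n "\<lambda>_. True"] unfolding unimod_ser by (simp add: u_def gf_unimodal_max del: power_Suc)
  qed
qed

section \<open>The crank\<close>

definition crank_class :: "nat \<Rightarrow> nat \<Rightarrow> nat multiset set" where
  "crank_class w s = {p. (\<forall>x\<in>#p. 0 < x) \<and> ones p = w \<and> parts_above_ones p = s}"

text \<open>A partition splits into its \<open>w\<close> ones, its parts from 2 to \<open>w\<close>,
  and its \<open>s\<close> parts above \<open>w\<close>. The resulting expression is visibly
  symmetric in \<open>w\<close> and \<open>s\<close>.\<close>

lemma gf_crank_class:
  assumes "w > 0"
  shows "gf (crank_class w s) sum_mset =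
    (1 - fps_X) * (fps_X ^ (w + s + w * s) * (qinv w * qinv s))"
proof -
  define h :: "nat multiset \<times> nat multiset \<Rightarrow> nat multiset"
    where "h = (\<lambda>(A, B). replicate_mset w 1 + A + B)"
  let ?D = "with_parts {2..w} \<times> of_size_above w s"
  have bij: "bij_betw h ?D (crank_class w s)"
  proof (rule bij_betw_byWitness[where
        f' = "\<lambda>p. ({#x \<in># p. 2 \<le> x \<and> x \<le> w#}, {#x \<in># p. w < x#})"])
    have A: "{#x \<in># h (A, B). 2 \<le> x \<and> x \<le> w#} = A" "{#x \<in># h (A, B). w < x#} = B" "count (h (A, B)) 1 = w"
      if "A \<in> with_parts {2..w}" "B \<in> of_size_above w s" for A B
    proof -
      have A0: "count A x = 0" if "x < 2 \<or> w < x" for x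
        using \<open>A \<in> with_parts {2..w}\<close> that by (auto simp: with_parts_def not_in_iff[symmetric])
      have B0: "count B x = 0" if "x \<le> w" for x
        using \<open>B \<in> of_size_above w s\<close> that by (auto simp: of_size_above_def not_in_iff[symmetric])
      show "{#x \<in># h (A, B). 2 \<le> x \<and> x \<le> w#} = A" "{#x \<in># h (A, B). w < x#} = B" "count (h (A, B)) 1 = w"
        using assms by (auto intro!: multiset_eqI simp: h_def A0 B0)
    qed
    then show "\<forall>p\<in>?D. ({#x \<in># h p. 2 \<le> x \<and> x \<le> w#}, {#x \<in># h p. w < x#}) = p"
      by auto
    show "h ` ?D \<subseteq> crank_class w s"
    proof clarify
      fix a b
      assume ab: "a \<in> with_parts {2..w}" "b \<in> of_size_above w s"
      have "\<forall>x\<in>#h (a, b). 0 < x"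
        using ab by (auto simp: h_def with_parts_def of_size_above_def subset_iff)
      then show "h (a, b) \<in> crank_class w s"
        using A[OF ab] ab(2) by (simp add: crank_class_def ones_def parts_above_ones_def of_size_above_def)
    qed
    show "\<forall>p\<in>crank_class w s. h ({#x \<in># p. 2 \<le> x \<and> x \<le> w#}, {#x \<in># p. w < x#}) = p"
    proof
      fix p
      assume p: "p \<in> crank_class w s"
      then have "count p 0 = 0" "count p 1 = w"
        by (auto simp: crank_class_def ones_def not_in_iff[symmetric])
      then have "count (h ({#x \<in># p. 2 \<le> x \<and> x \<le> w#}, {#x \<in># p. w < x#})) x = count p x" for x
        using assms by (cases "x = 0"; cases "x = 1") (auto simp: h_def)
      then show "h ({#x \<in># p. 2 \<le> x \<and> x \<le> w#}, {#x \<in># p. w < x#}) = p"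
        by (rule multiset_eqI)
    qed
    show "(\<lambda>p. ({#x \<in># p. 2 \<le> x \<and> x \<le> w#}, {#x \<in># p. w < x#})) ` crank_class w s \<subseteq> ?D"
      by (auto simp: crank_class_def with_parts_def of_size_above_def parts_above_ones_def)
  qed
  have "gf (crank_class w s) sum_mset = fps_X ^ w * (pgf {2..w} * gf (of_size_above w s) sum_mset)"
    by (rule gf_prod[OF bij]) (simp_all add: h_def fin_fibres_with_parts fin_fibres_of_size_above)
  moreover have "pgf {2..w} = (1 - fps_X) * qinv w"
  proof -
    have "{1..w} = insert 1 {2..w}"
      using assms by auto
    then show ?thesis
      using pgf_insert[of 1 "{2..w}"] by (simp add: qinv_def)
  qed
  ultimately show ?thesis
    unfolding gf_of_size_above by (simp add: power_add ac_simps)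
qed

lemma pgf_no_ones: "pgf {2..} = (1 - fps_X) * partitions_gf"
proof -
  have "{1::nat..} = insert 1 {2..}"
    by auto
  then show ?thesis
    using pgf_insert[of 1 "{2..}"] by (simp add: partitions_gf_def)
qed

lemma finite_partitions: "finite {p. partition_of p n}"
  using fin_fibresD[OF fin_fibres_positive, of n] by (simp add: partition_of_def)

lemma crank_pos_no_ones:
  assumes "partition_of p n" "0 < n" "ones p = 0"
  shows "0 < crank p"
proof -
  have "p \<noteq> {#}"
    using assms by (auto simp: partition_of_def)
  then have "Max (set_mset p) \<in># p"
    by simp
  then show ?thesis
    using assms by (auto simp: crank_def partition_of_def)
qed

text \<open>A common form for all crank conditions: they are constant on partitions without ones and
  otherwise depend only on the crank class.\<close>

lemma card_partitions_by_ones: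
  assumes r0: "\<And>p. partition_of p n \<Longrightarrow> ones p = 0 \<Longrightarrow> Q p = Q0"
    and Q: "\<And>p. partition_of p n \<Longrightarrow> 0 < ones p \<Longrightarrow> Q p = R (ones p) (parts_above_ones p)"
  shows "int (card {p. partition_of p n \<and> Q p}) =
    (if Q0 then pgf {2..} $ n else 0) +
    (\<Sum>w\<in>{1..n}. \<Sum>s\<le>n. if R w s then gf (crank_class w s) sum_mset $ n else 0)"
proof -
  define Z where "Z = {p. partition_of p n \<and> Q p \<and> ones p = 0}"
  define W where "W = {p. partition_of p n \<and> Q p \<and> 0 < ones p}"
  have fin: "finite Z" "finite W"
    using finite_partitions unfolding Z_def W_def by (auto elim: rev_finite_subset)
  have ones_le: "ones p \<le> n" if "partition_of p n" for p
    using that count_le_size[of p 1] size_le_sum_mset[of p] by (simp add: partition_of_def ones_def)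
  have above_le: "parts_above_ones p \<le> n" if "partition_of p n" for p
    using that order_trans[OF size_filter_mset_lesseq size_le_sum_mset, of p]
    by (simp add: partition_of_def parts_above_ones_def)
  have "{p. partition_of p n \<and> Q p} = Z \<union> W" "Z \<inter> W = {}"
    by (auto simp: Z_def W_def)
  then have "card {p. partition_of p n \<and> Q p} = card Z + card W"
    using fin by (simp add: card_Un_disjoint)
  moreover have "int (card Z) = (if Q0 then pgf {2..} $ n else 0)"
  proof -
    have "p \<in> with_parts {2..} \<longleftrightarrow> (\<forall>x\<in>#p. 0 < x) \<and> ones p = 0" for p
    proof
      assume p: "(\<forall>x\<in>#p. 0 < x) \<and> ones p = 0"
      have "2 \<le> x" if "x \<in># p" for x
      proof -
        have "x \<noteq> 0" "x \<noteq> 1"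
          using p that by (auto simp: ones_def not_in_iff[symmetric])
        then show ?thesis
          by simp
      qed
      then show "p \<in> with_parts {2..}"
        by (auto simp: with_parts_def)
    qed (fastforce simp: with_parts_def ones_def not_in_iff[symmetric])
    then have "p \<in> Z \<longleftrightarrow> Q0 \<and> p \<in> with_parts {2..} \<and> sum_mset p = n" for p
      using r0[of p] by (auto simp: Z_def partition_of_def)
    then have "Z = (if Q0 then {p \<in> with_parts {2..}. sum_mset p = n} else {})"
      by auto
    then show ?thesis
      by (simp add: gf_nth)
  qed
  moreover have "int (card W) =
      (\<Sum>w\<in>{1..n}. \<Sum>s\<le>n. if R w s then gf (crank_class w s) sum_mset $ n else 0)"
  proof -
    let ?f = "\<lambda>p. (ones p, parts_above_ones p)"
    have "card W = (\<Sum>y\<in>{1..n} \<times> {..n}. card {p \<in> W. ?f p = y})"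
    proof -
      have "?f ` W \<subseteq> {1..n} \<times> {..n}"
        using ones_le above_le by (auto simp: W_def)
      from sum.group[OF fin(2) _ this, of "\<lambda>_. 1 :: nat"] show ?thesis
        unfolding card_eq_sum by simp
    qed
    moreover have "int (card {p \<in> W. ?f p = (w, s)}) =
        (if R w s then gf (crank_class w s) sum_mset $ n else 0)" if "w \<in> {1..n}" for w s
    proof -
      have "p \<in> W \<and> ?f p = (w, s) \<longleftrightarrow> R w s \<and> p \<in> crank_class w s \<and> sum_mset p = n" for p
        using that Q[of p] by (auto simp: W_def crank_class_def partition_of_def)
      then show ?thesis
        by (simp add: gf_nth)
    qed
    ultimately have "int (card W) =
        (\<Sum>(w, s)\<in>{1..n} \<times> {..n}. if R w s then gf (crank_class w s) sum_mset $ n else 0)"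
      unfolding of_nat_sum by (auto simp del: One_nat_def intro!: sum.cong)
    then show ?thesis
      by (simp add: sum.cartesian_product)
  qed
  ultimately show ?thesis
    by simp
qed

text \<open>This sorts the partitions with parts at most \<open>M\<close> by their largest part
  \<open>w\<close>.\<close>

lemma sum_X_power_mult_qinv: "(\<Sum>w\<le>M. fps_X ^ w * qinv w) = qinv M"
proof (induction M)
  case (Suc M)
  then show ?case
    unfolding sum.atMost_Suc Suc qinv_Suc[of M, symmetric] by (simp add: algebra_simps del: power_Suc)
qed simp

lemma one_minus_X_nth: "n \<ge> 2 \<Longrightarrow> (1 - fps_X :: int fps) $ n = 0"
  by (simp add: fps_X_def)

text \<open>Partitions without ones balance those that have ones but no part above their number. The
  missing summand \<open>w = 0\<close> is \<open>1 - fps_X\<close>, which vanishes from degree 2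
  on.\<close>

lemma pgf_no_ones_nth:
  assumes "n \<ge> 2"
  shows "pgf {2..} $ n = (\<Sum>w\<in>{1..n}. gf (crank_class w 0) sum_mset $ n)"
proof -
  have "pgf {2..} $ n = ((1 - fps_X) * qinv n) $ n"
    unfolding pgf_no_ones by (intro fps_mult_nth_cong) (simp_all add: partitions_gf_nth)
  also have "\<dots> = (\<Sum>w\<le>n. ((1 - fps_X) * (fps_X ^ w * qinv w)) $ n)"
    by (simp only: sum_X_power_mult_qinv[symmetric, of n] sum_distrib_left fps_sum_nth)
  also have "\<dots> = (\<Sum>w\<in>{1..n}. ((1 - fps_X) * (fps_X ^ w * qinv w)) $ n)"
    using one_minus_X_nth[OF assms] by (simp add: sum_atMost_split_0)
  also have "\<dots> = (\<Sum>w\<in>{1..n}. gf (crank_class w 0) sum_mset $ n)"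
    by (intro sum.cong) (simp_all add: gf_crank_class)
  finally show ?thesis .
qed

lemma card_crank_0:
  assumes "n \<ge> 2"
  shows "int (card {p. partition_of p n \<and> crank p = 0}) = ((1 - fps_X) * crank_ser 2) $ n"
proof -
  have "int (card {p. partition_of p n \<and> crank p = 0}) =
      (if False then pgf {2..} $ n else 0) +
      (\<Sum>w\<in>{1..n}. \<Sum>s\<le>n. if s = w then gf (crank_class w s) sum_mset $ n else 0)"
  proof (rule card_partitions_by_ones)
    show "(crank p = 0) = False" if "partition_of p n" "ones p = 0" for p
      using crank_pos_no_ones[OF that(1) _ that(2)] assms by simp
  qed (auto simp: crank_def)
  also have "\<dots> = (\<Sum>w\<in>{1..n}. gf (crank_class w w) sum_mset $ n)"
    by simp
  also have "\<dots> = (\<Sum>w\<in>{1..n}. ((1 - fps_X) * (fps_X ^ (w * w + 2 * w) * (qinv w * qinv w))) $ n)"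
    by (intro sum.cong) (simp_all add: gf_crank_class mult_2_right ac_simps)
  \<comment> \<open>The added summand \<open>w = 0\<close> is \<open>1 - fps_X\<close>, invisible
    since \<open>n \<ge> 2\<close>.\<close>
  also have "\<dots> = (\<Sum>w\<le>n. ((1 - fps_X) * (fps_X ^ (w * w + 2 * w) * (qinv w * qinv w))) $ n)"
    using one_minus_X_nth[OF assms] by (simp add: sum_atMost_split_0)
  also have "\<dots> = ((1 - fps_X) * (\<Sum>w\<le>n. fps_X ^ (w * w + 2 * w) * (qinv w * qinv w))) $ n"
    by (simp only: sum_distrib_left fps_sum_nth)
  also have "\<dots> = ((1 - fps_X) * crank_ser 2) $ n"
    by (intro fps_mult_nth_cong) (simp_all add: crank_ser_nth[of _ n])
  finally show ?thesis .
qed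

text \<open>For positive \<open>w\<close> and \<open>s\<close> the classes \<open>crank_class w s\<close> and \<open>crank_class s w\<close> are equinumerous,
  and the partitions without ones balance the classes with \<open>s = 0\<close>.\<close>

lemma card_crank_nonneg:
  assumes "n \<ge> 2"
  shows "2 * int (card {p. partition_of p n \<and> 0 \<le> crank p}) =
    partitions_gf $ n + int (card {p. partition_of p n \<and> crank p = 0})"
proof -
  define c where "c w s = gf (crank_class w s) sum_mset $ n" for w s
  define r where "r = pgf {2..} $ n"
  have c_sym: "c w s = c s w" if "w > 0" "s > 0" for w s
    using that by (simp add: c_def gf_crank_class ac_simps)
  have ge: "int (card {p. partition_of p n \<and> 0 \<le> crank p}) =
      (if True then r else 0) + (\<Sum>w\<in>{1..n}. \<Sum>s\<le>n. if w \<le> s then c w s else 0)"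
    unfolding c_def r_def by (rule card_partitions_by_ones) (auto simp: crank_def)
  have eq: "int (card {p. partition_of p n \<and> crank p = 0}) =
      (if False then r else 0) + (\<Sum>w\<in>{1..n}. \<Sum>s\<le>n. if w = s then c w s else 0)"
    unfolding c_def r_def
  proof (rule card_partitions_by_ones)
    show "(crank p = 0) = False" if "partition_of p n" "ones p = 0" for p
      using crank_pos_no_ones[OF that(1) _ that(2)] assms by simp
  qed (auto simp: crank_def)
  have "int (card {p. partition_of p n \<and> True}) =
      (if True then r else 0) + (\<Sum>w\<in>{1..n}. \<Sum>s\<le>n. if True then c w s else 0)"
    unfolding c_def r_def by (rule card_partitions_by_ones) auto
  moreover have "int (card {p. partition_of p n \<and> True}) = partitions_gf $ n"
  proof -
    have "set_mset p \<subseteq> {1..} \<longleftrightarrow> (\<forall>x\<in>#p. 0 < x)" for p :: "nat multiset"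
      by (auto simp: Suc_le_eq)
    then show ?thesis
      by (simp add: partitions_gf_def gf_nth with_parts_def partition_of_def)
  qed
  ultimately have all: "partitions_gf $ n = r + (\<Sum>w\<in>{1..n}. \<Sum>s\<le>n. c w s)"
    by simp
  \<comment> \<open>\<open>g w s\<close> is \<open>c w s\<close> times the sign of
    \<open>s - w\<close>, hence antisymmetric for positive arguments.\<close>
  define g where "g w s = (if w \<le> s then 2 * c w s else 0) - c w s - (if w = s then c w s else 0)" for w s
  have "2 * int (card {p. partition_of p n \<and> 0 \<le> crank p}) -
      partitions_gf $ n - int (card {p. partition_of p n \<and> crank p = 0}) =
      r + (\<Sum>w\<in>{1..n}. \<Sum>s\<le>n. g w s)"
  proof -
    have "(\<Sum>w\<in>{1..n}. \<Sum>s\<le>n. g w s) = 2 * (\<Sum>w\<in>{1..n}. \<Sum>s\<le>n. if w \<le> s then c w s else 0)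
        - (\<Sum>w\<in>{1..n}. \<Sum>s\<le>n. c w s) - (\<Sum>w\<in>{1..n}. \<Sum>s\<le>n. if w = s then c w s else 0)"
      unfolding g_def sum_subtractf sum_distrib_left by (simp add: if_distrib cong: if_cong)
    then show ?thesis
      unfolding ge eq all by simp
  qed
  also have "(\<Sum>w\<in>{1..n}. \<Sum>s\<le>n. g w s) =
      (\<Sum>w\<in>{1..n}. g w 0) + (\<Sum>w\<in>{1..n}. \<Sum>s\<in>{1..n}. g w s)"
    unfolding sum_atMost_split_0 sum.distrib ..
  also have "(\<Sum>w\<in>{1..n}. \<Sum>s\<in>{1..n}. g w s) = 0"
    by (rule sum_antisymmetric) (auto simp: g_def c_sym)
  also have "(\<Sum>w\<in>{1..n}. g w 0) = - r"
    unfolding r_def pgf_no_ones_nth[OF assms] c_def[symmetric] sum_negf[symmetric]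
    by (intro sum.cong) (auto simp: g_def)
  finally show ?thesis
    by simp
qed

section \<open>The truncated series\<close>

definition unimod_gf :: "nat \<Rightarrow> int fps" where
  "unimod_gf m = (if m = 0 then unimod_ser 1 - unimod_ser 2 else unimod_ser m)"

lemma u_eq_nth: "int (u m (int n)) = unimod_gf m $ n"
  using u_0_eq u_Suc_eq by (cases m) (simp_all add: unimod_gf_def)

lemma C2_eq_nth: "n > 0 \<Longrightarrow> C2 n = (qpoch_inf * unimod_ser 2) $ n"
proof (cases "n = 1")
  case True
  \<comment> \<open>Up to degree 2 the series \<open>crank_ser 2\<close> is 1, so the convention
    \<open>C2 1 = -1\<close> is the value the identity predicts.\<close>
  have "((1 - fps_X) * crank_ser 2) $ 1 = - 1"
    using crank_ser_nth_small[of 0 2] crank_ser_nth_small[of 1 2] by simp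
  then show ?thesis
    using True by (simp add: C2_def qpoch_inf_unimod_ser_2)
next
  case False
  moreover assume "n > 0"
  ultimately show ?thesis
    using card_crank_0[of n] by (simp add: C2_def qpoch_inf_unimod_ser_2)
qed

text \<open>The relation \<open>card_crank_nonneg\<close> has the shape of
  \<open>qpoch_inf_unimod_ser_1\<close>; at \<open>n = 1\<close> the conventions satisfy it too, as
  \<open>0 = 1 - 1\<close>.\<close>

lemma C1_eq_nth:
  assumes "n > 0"
  shows "C1 n = (qpoch_inf * unimod_ser 1) $ n"
proof -
  have "2 * C1 n = partitions_gf $ n + C2 n"
  proof (cases "n = 1")
    case True
    have "qinv 1 $ 1 = 1"
      using arg_cong[OF qinv_Suc[of 0], of "\<lambda>f. f $ 0"] arg_cong[OF qinv_Suc[of 0], of "\<lambda>f. f $ 1"]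
      by simp
    then show ?thesis
      using True partitions_gf_nth[of 1 1] by (simp add: C1_def C2_def)
  next
    case False
    then show ?thesis
      using assms card_crank_nonneg[of n] by (simp add: C1_def C2_def)
  qed
  also have "\<dots> = (2 * (qpoch_inf * unimod_ser 1)) $ n"
    unfolding C2_eq_nth[OF assms] qpoch_inf_unimod_ser_1 by simp
  finally show ?thesis
    by (simp add: numeral_fps_const)
qed

lemma C0_eq: "C0 n = C1 n - C2 n"
proof (cases "n = 1")
  case False
  have "{p. partition_of p n \<and> 0 \<le> crank p} =
      {p. partition_of p n \<and> 0 < crank p} \<union> {p. partition_of p n \<and> crank p = 0}"
    by auto
  moreover have "finite {p. partition_of p n \<and> 0 < crank p}" "finite {p. partition_of p n \<and> crank p = 0}"
    using finite_partitions by (auto elim: rev_finite_subset)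
  moreover have "{p. partition_of p n \<and> 0 < crank p} \<inter> {p. partition_of p n \<and> crank p = 0} = {}"
    by auto
  ultimately have "card {p. partition_of p n \<and> 0 \<le> crank p} =
      card {p. partition_of p n \<and> 0 < crank p} + card {p. partition_of p n \<and> crank p = 0}"
    by (simp add: card_Un_disjoint)
  then show ?thesis
    using False by (simp add: C0_def C1_def C2_def)
qed (simp add: C0_def C1_def C2_def)

lemma C_eq_nth:
  assumes "n > 0" "m \<in> {0, 1, 2}"
  shows "C m n = (qpoch_inf * unimod_gf m) $ n"
  using assms
  by (auto simp: C_def unimod_gf_def C0_eq C1_eq_nth C2_eq_nth right_diff_distrib)

lemma X_power_mult_unimod_gf_nth:
  "(fps_X ^ e * unimod_gf m) $ n = int (u m (int n - int e))"
proof (cases "n < e")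
  case True
  then show ?thesis
    by (simp add: u_def)
next
  case False
  then have "int n - int e = int (n - e)"
    by simp
  then show ?thesis
    using False by (simp only: fps_X_power_mult_nth u_eq_nth) simp
qed

section \<open>Monotonicity\<close>

lemma unimodal_Cons_1:
  assumes "unimodal zs" "\<forall>x\<in>set zs. 0 < x"
  shows "unimodal (Suc 0 # zs)"
proof -
  obtain t where "t < length zs" "sorted (take (Suc t) zs)" "sorted_wrt (\<ge>) (drop t zs)"
    using assms(1) by (auto simp: unimodal_def)
  then show ?thesis
    unfolding unimodal_def using assms(2)
    by (intro exI[of _ "Suc t"]) (auto dest!: in_set_takeD simp: Suc_le_eq)
qed

lemma count_list_replicate: "count_list (replicate n x) y = (if x = y then n else 0)"
  by (induction n) auto

text \<open>If the maximum were 1, the list would consist of \<open>m\<close> ones and have sum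
  \<open>m\<close>, not \<open>n + m\<close>.\<close>

lemma count_list_Max_gt_1:
  assumes "composition zs (n + m)" "n > 0" "zs \<noteq> []" "count_list zs (Max (set zs)) = m"
  shows "1 < Max (set zs)"
proof (rule ccontr)
  assume le1: "\<not> 1 < Max (set zs)"
  have "x = 1" if x: "x \<in> set zs" for x
  proof -
    have "x \<le> Max (set zs)" "0 < x"
      using x assms(1) by (auto simp: composition_def)
    then show ?thesis
      using le1 by linarith
  qed
  then have zs: "zs = replicate (length zs) 1"
    by (simp add: replicate_eqI)
  then have "Max (set zs) = 1"
    using assms(3) by (metis Max_singleton length_0_conv set_replicate)
  moreover have "sum_list zs = length zs" "count_list zs 1 = length zs"
    by (subst zs, simp add: sum_list_replicate, subst zs, simp add: count_list_replicate)
  ultimately show False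
    using assms by (simp add: composition_def)
qed

text \<open>Prepending 1 is injective. For \<open>m > 0\<close>, the condition \<open>n > 0\<close>
  forces the maximum above 1, so its multiplicity is unchanged.\<close>

lemma u_le_Suc:
  assumes "n > 0"
  shows "u m (int n) \<le> u m (int (Suc n))"
proof (cases "m = 0")
  case True
  have "card {xs. composition xs n \<and> unimodal xs} \<le> card {xs. composition xs (Suc n) \<and> unimodal xs}"
  proof (rule card_inj_on_le[where f = "(#) 1"])
    show "finite {xs. composition xs (Suc n) \<and> unimodal xs}"
      by (rule finite_compositions_conj)
  qed (auto simp: composition_def intro: unimodal_Cons_1)
  then show ?thesis
    using True assms by (simp add: u_def nat_add_distrib)
next
  case False
  let ?S = "\<lambda>n. {xs. composition xs (n + m) \<and> unimodal xs \<and> count_list xs (Max (set xs)) = m}"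
  have "card (?S n) \<le> card (?S (Suc n))"
  proof (rule card_inj_on_le[where f = "(#) 1"])
    show "finite (?S (Suc n))"
      by (rule finite_compositions_conj)
    show "(#) 1 ` ?S n \<subseteq> ?S (Suc n)"
    proof (rule image_subsetI)
      fix zs
      assume "zs \<in> ?S n"
      then have zs: "composition zs (n + m)" "unimodal zs" "count_list zs (Max (set zs)) = m"
        by auto
      then have "zs \<noteq> []"
        by (auto simp: unimodal_def)
      with zs have gt: "1 < Max (set zs)"
        using count_list_Max_gt_1 assms by metis
      have "Max (set (1 # zs)) = max 1 (Max (set zs))"
        using \<open>zs \<noteq> []\<close> by simp
      also have "\<dots> = Max (set zs)"
        using gt by (simp only: max_def) simp
      finally have Max: "Max (set (1 # zs)) = Max (set zs)" .
      have "composition (1 # zs) (Suc n + m)" "unimodal (1 # zs)"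
        using zs unimodal_Cons_1[of zs] by (auto simp: composition_def)
      moreover have "count_list (1 # zs) (Max (set zs)) = m"
        using zs(3) gt by simp
      ultimately show "1 # zs \<in> ?S (Suc n)"
        unfolding mem_Collect_eq Max by blast
    qed
  qed simp
  then show ?thesis
    using False by (simp add: u_def nat_add_distrib)
qed

text \<open>The witness has \<open>n - m\<close> ones followed by \<open>m\<close> twos, with sum
  \<open>n + m\<close> and its peak at the end.\<close>

lemma u_pos:
  assumes "0 < m" "m \<le> n"
  shows "0 < u m (int n)"
proof -
  let ?S = "{xs. composition xs (n + m) \<and> unimodal xs \<and> count_list xs (Max (set xs)) = m}"
  define zs :: "nat list" where "zs = replicate (n - m) 1 @ replicate m 2"
  have "unimodal zs"
    unfolding unimodal_def
  proof (intro exI conjI)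
    show "length zs - 1 < length zs"
      using assms by (simp add: zs_def)
    show "sorted (take (Suc (length zs - 1)) zs)"
      using assms by (simp add: zs_def sorted_append)
    show "sorted_wrt (\<ge>) (drop (length zs - 1) zs)"
      by (rule sorted_wrt01) simp
  qed
  moreover have "Max (set zs) = 2"
    using assms by (intro Max_eqI) (auto simp: zs_def)
  ultimately have "zs \<in> ?S"
    using assms by (auto simp: composition_def zs_def sum_list_replicate count_list_replicate)
  moreover have "finite ?S"
    by (rule finite_compositions_conj)
  ultimately have "0 < card ?S"
    by (auto simp: card_gt_0_iff)
  then show ?thesis
    using assms by (simp add: u_def)
qed

text \<open>A step of length 2 is needed because \<open>u 2 0 = 1\<close> and \<open>u 2 1 = 0\<close>.\<close>

lemma u_mono:
  assumes "m \<le> 2" "x + 2 \<le> y"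
  shows "u m x \<le> u m y"
proof (cases "x < 0")
  case True
  then show ?thesis
    by (simp add: u_def)
next
  case False
  define a b where "a = nat x" and "b = nat y"
  have ab: "x = int a" "y = int b" "a + 2 \<le> b"
    using False assms by (auto simp: a_def b_def)
  show ?thesis
  proof (cases "a = 0")
    case True
    show ?thesis
    proof (cases "m = 0")
      case False
      then have "int (u m 0) = 1"
        using u_eq_nth[of m 0] by (simp add: unimod_gf_def unimod_ser_nth_small)
      then show ?thesis
        using u_pos[of m b] False True ab assms(1) by simp
    qed (simp add: u_def ab True)
  next
    case False
    have "u m (int a) \<le> u m (int (a + i))" for i
    proof (induction i)
      case (Suc i)
      then show ?case
        using u_le_Suc[of "a + i" m] False by simp
    qed simp
    from this[of "b - a"] show ?thesis
      using ab by simp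
  qed
qed

theorem corollary1p5:
  fixes k n m :: nat
  assumes "k > 0" and "n > 0" and "m \<in> {0, 1, 2}"
  shows "(-1) ^ (k - 1) *
    (C m n - (\<Sum>j = - int k..int k.
       (-1) ^ nat \<bar>j\<bar> * int (u m (int n - j * (3 * j - 1) div 2)))) \<ge> 0"
proof -
  define a where "a i = int (u m (int n - int (pent i))) + int (u m (int n - int (pent_neg i)))" for i
  \<comment> \<open>The cutoff \<open>n + k\<close> is at least \<open>n\<close>, as the pentagonal
    expansion requires, and at least \<open>k\<close>.\<close>
  have C: "C m n = int (u m (int n)) + (\<Sum>i=1..n + k. (-1) ^ i * a i)"
    unfolding C_eq_nth[OF assms(2,3)] qpoch_inf_mult_nth[of n "n + k", OF le_add1]
      X_power_mult_unimod_gf_nth a_def u_eq_nth ..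
  have S: "(\<Sum>j = - int k..int k. (-1) ^ nat \<bar>j\<bar> * int (u m (int n - j * (3 * j - 1) div 2))) =
      int (u m (int n)) + (\<Sum>i=1..k. (-1) ^ i * a i)"
    unfolding sum_symmetric_interval pent_int pent_neg_int a_def by (simp add: distrib_left)
  \<comment> \<open>Consecutive exponents differ by \<open>3 * i + 1\<close> or
    \<open>3 * i + 2\<close>, enough for the step of 2 in \<open>u_mono\<close>.\<close>
  have anti: "a (Suc i) \<le> a i" if "k < i" for i
    unfolding a_def using that assms(3)
    by (intro add_mono of_nat_mono u_mono) (auto simp: pent_Suc pent_neg_Suc)
  have "0 \<le> a i" for i
    by (simp add: a_def)
  from alternating_tail_nonneg[of k a n, OF assms(1) anti this] show ?thesis
    unfolding C S by (simp only: add_diff_cancel_left)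
qed

end
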